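(* Consider a sequence of adjacency matrices $Y^n$ generated by a regular latent position network model (LPM) on $S\subseteq\mathbb{R}^d$ with link probability function $K$ and bounding function $G$, possessing $a(n)$-$b(n)$ distinctly bunched eigenvalues, and with $\|Z_i\|\le G(n)$ for all $1\le i\le n$ and all $n$. Let $$\alpha^K_n=\sup_{0< x\le 2G(n)}\frac{|K'(x)|}{|x|K(x)\epsilon},\qquad \beta^K_n=\sup_{0< x\le 2G(n)}\frac{x^2K(x)}{K'(x)^2},$$ where $\epsilon>0$ is such that $K\le1-\epsilon$, and let $\hat Z(Y^n)$ be the restricted maximum likelihood estimator. Then there is a constant $C>0$, not depending on $n$, such that $$\mathbb{P}\left(\inf_{O\in\mathcal{O}_d,\;Q\in\mathcal{Q}_{nd}}\|\hat Z(Y^n)O-Z-Q\|_F^2\ge 3(d-1)\,a(n)+\frac{50(d+2)\,2^9e\,\alpha^K_n\beta^K_nG(n)^2n^{1.5}}{b(n)}\right)\le\frac{C}{n^2}.$$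
   Context: $\mathbb{R}_+=[0,\infty)$; $e$ is Euler's number. LPM: for each $n$, nodes $1,\dots,n$ have latent positions $Z_1,\dots,Z_n\in S\subseteq\mathbb{R}^d$ (rows of $Z\in\mathbb{R}^{n\times d}$), and conditional on them $Y^n\in\{0,1\}^{n\times n}$ is a symmetric zero-diagonal adjacency matrix whose entries $Y^n_{ij}$, $i<j$, are independent with $\mathbb{P}(Y^n_{ij}=1\mid Z)=K(\|Z_i-Z_j\|)$, where $K:\mathbb{R}_+\to[0,1]$ does not depend on $n$. Regular LPM: (1) $K$ is known, monotonically decreasing, differentiable, and upper bounded by $1-\epsilon$ for some $\epsilon>0$; (2) $S\subseteq\mathbb{R}^d$; (3) there is a known differentiable function $G(n)$ such that $\mathbb{P}(\max_{1\le i\le n}\|Z_i\|\le G(n))\to1$ as $n\to\infty$. Restricted maximum likelihood estimator: $\hat Z(Y^n)\in\operatorname{argmax}\{L(z:Y^n): z\in\mathbb{R}^{n\times d},\ \|z_i\|\le G(n)\ \forall i\in\{1,\dots,n\}\}$, where $$L(z:Y^n)=\sum_{i=1}^n\sum_{j=1}^n Y^n_{ij}\log K(\|z_i-z_j\|)+(1-Y^n_{ij})\log(1-K(\|z_i-z_j\|)).$$ $\|\cdot\|_F$ is the Frobenius norm, $\mathcal{O}_d$ the set of $d\times d$ orthogonal matrices, $\mathcal{Q}_{nd}$ the set of $n\times d$ real matrices with identical rows. The suprema $\alpha^K_n,\beta^K_n$ take values in $[0,\infty]$. Distinctly bunched eigenvalues: let $\mathcal{C}_n=I_n-\frac1n1_n1_n^T$,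 where $I_n$ is the identity and $1_n$ the $n\times1$ vector of ones. Let $\lambda_1\ge\cdots\ge\lambda_d$ denote the $d$ nonzero eigenvalues of $\mathcal{C}_nZZ^T\mathcal{C}_n$ and set $\lambda_{d+1}:=0$ (these depend on $n$ and $Z$). For functions $a,b:\mathbb{N}\to\mathbb{R}$, the LPM possesses $a(n)$-$b(n)$ distinctly bunched eigenvalues if there exist $k\in\{1,\dots,d\}$ and integers $1=i_1<i_2<\cdots<i_k<i_{k+1}=d+1$ such that (for all $n>d$) $$\frac{(\lambda_{i_{j+1}-1}-\lambda_{i_j})^2}{\lambda_{i_{j+1}-1}}\le a(n)\quad\text{and}\quad\frac{(\lambda_{i_{j+1}-1}-\lambda_{i_{j+1}})^2}{\lambda_{i_j}}\ge b(n)\quad\text{for all }j\in\{1,\dots,k\}.$$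
   Formalization: It is additionally assumed that b(n) ≥ 0 for all n > d; for negative b(n) the bunching condition on b is void, the threshold can be negative, and the claimed probability bound then fails. *)

theory Defs
  imports "HOL-Probability.Probability" "Jordan_Normal_Form.Char_Poly"
begin

no_notation Matrix.vec_index (infixl "$" 100)

text \<open>Node labels are \<open>0, \<dots>, n - 1\<close>.  A matrix in \<open>\<real>\<^bsup>n\<times>d\<^esup>\<close>, with \<open>d = CARD('d)\<close>, is given by its
  rows, as a function \<open>nat \<Rightarrow> real ^ 'd\<close> of which only the values below \<open>n\<close> matter.\<close>

subsection \<open>Conditional probability and conditional independence\<close>

definition cond_prob_alg :: "'w measure \<Rightarrow> 'w measure \<Rightarrow> 'w set \<Rightarrow> 'w \<Rightarrow> real" where
  "cond_prob_alg M F A = real_cond_exp M F (indicat_real A)"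

definition cond_indep_vars ::
  "'w measure \<Rightarrow> 'w measure \<Rightarrow> ('i \<Rightarrow> 'b measure) \<Rightarrow> ('i \<Rightarrow> 'w \<Rightarrow> 'b) \<Rightarrow> 'i set \<Rightarrow> bool" where
  "cond_indep_vars M F N X I \<longleftrightarrow>
     (\<forall>i\<in>I. X i \<in> measurable M (N i)) \<and>
     (\<forall>J A. J \<subseteq> I \<longrightarrow> finite J \<longrightarrow> (\<forall>j\<in>J. A j \<in> sets (N j)) \<longrightarrow>
        (AE \<omega> in M. cond_prob_alg M F {\<omega>' \<in> space M. \<forall>j\<in>J. X j \<omega>' \<in> A j} \<omega>
           = (\<Prod>j\<in>J. cond_prob_alg M F {\<omega>' \<in> space M. X j \<omega>' \<in> A j} \<omega>)))"

subsection \<open>Latent position models\<close>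

definition adjacency_matrices :: "nat \<Rightarrow> real mat set" where
  "adjacency_matrices n = {y \<in> carrier_mat n n.
     (\<forall>i<n. \<forall>j<n. y $$ (i, j) \<in> {0, 1} \<and> y $$ (i, j) = y $$ (j, i)) \<and>
     (\<forall>i<n. y $$ (i, i) = 0)}"

definition latent_algebra ::
  "'w measure \<Rightarrow> nat \<Rightarrow> ('w \<Rightarrow> nat \<Rightarrow> real ^ 'd) \<Rightarrow> 'w measure" where
  "latent_algebra M n Z =
     vimage_algebra (space M) (\<lambda>\<omega>. \<lambda>i\<in>{..<n}. Z \<omega> i) (\<Pi>\<^sub>M i\<in>{..<n}. borel)"

text \<open>The models for different \<open>n\<close> may live on different probability spaces \<open>M n\<close>.\<close>

definition lpm ::
  "(nat \<Rightarrow> 'w measure) \<Rightarrow> (real ^ 'd) set \<Rightarrow> (real \<Rightarrow> real) \<Rightarrow>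
   (nat \<Rightarrow> 'w \<Rightarrow> nat \<Rightarrow> real ^ 'd) \<Rightarrow> (nat \<Rightarrow> 'w \<Rightarrow> real mat) \<Rightarrow> bool" where
  "lpm M S K Z Y \<longleftrightarrow>
     (\<forall>x\<ge>0. 0 \<le> K x \<and> K x \<le> 1) \<and>
     (\<forall>n\<ge>1. prob_space (M n) \<and>
        (\<forall>i<n. (\<lambda>\<omega>. Z n \<omega> i) \<in> borel_measurable (M n)) \<and>
        (AE \<omega> in M n. \<forall>i<n. Z n \<omega> i \<in> S) \<and>
        (\<forall>\<omega>\<in>space (M n). Y n \<omega> \<in> adjacency_matrices n) \<and>
        cond_indep_vars (M n) (latent_algebra (M n) n (Z n)) (\<lambda>_. borel)
          (\<lambda>(i, j) \<omega>. Y n \<omega> $$ (i, j)) {(i, j). i < j \<and> j < n} \<and>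
        (\<forall>i j. i < j \<and> j < n \<longrightarrow>
           (AE \<omega> in M n.
              cond_prob_alg (M n) (latent_algebra (M n) n (Z n))
                {\<omega>' \<in> space (M n). Y n \<omega>' $$ (i, j) = 1} \<omega>
              = K (norm (Z n \<omega> i - Z n \<omega> j)))))"

text \<open>At \<open>0\<close> differentiability of \<open>K\<close> is one-sided.  \<open>G\<close> is only ever evaluated at \<open>n \<ge> 1\<close>.\<close>

definition regular_lpm ::
  "(nat \<Rightarrow> 'w measure) \<Rightarrow> (real ^ 'd) set \<Rightarrow> (real \<Rightarrow> real) \<Rightarrow> real \<Rightarrow> (real \<Rightarrow> real) \<Rightarrow>
   (nat \<Rightarrow> 'w \<Rightarrow> nat \<Rightarrow> real ^ 'd) \<Rightarrow> (nat \<Rightarrow> 'w \<Rightarrow> real mat) \<Rightarrow> bool" where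
  "regular_lpm M S K \<epsilon> G Z Y \<longleftrightarrow>
     lpm M S K Z Y \<and>
     antimono_on {0..} K \<and> K differentiable_on {0..} \<and> \<epsilon> > 0 \<and> (\<forall>x\<ge>0. K x \<le> 1 - \<epsilon>) \<and>
     G differentiable_on {1..} \<and>
     (\<lambda>n. measure (M n) {\<omega> \<in> space (M n). (MAX i\<in>{..<n}. norm (Z n \<omega> i)) \<le> G (real n)})
       \<longlonglongrightarrow> 1"

subsection \<open>Restricted maximum likelihood\<close>

text \<open>Extended logarithm with \<open>log 0 = -\<infinity>\<close>; in \<open>ereal\<close>, \<open>0 * (-\<infinity>) = 0\<close>.\<close>

definition elog :: "real \<Rightarrow> ereal" where
  "elog p = (if p = 0 then -\<infinity> else ereal (ln p))"

definition log_likelihood ::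
  "(real \<Rightarrow> real) \<Rightarrow> nat \<Rightarrow> real mat \<Rightarrow> (nat \<Rightarrow> real ^ 'd) \<Rightarrow> ereal" where
  "log_likelihood K n y z = (\<Sum>i<n. \<Sum>j<n.
     ereal (y $$ (i, j)) * elog (K (norm (z i - z j))) +
     ereal (1 - y $$ (i, j)) * elog (1 - K (norm (z i - z j))))"

definition restricted_mle ::
  "(real \<Rightarrow> real) \<Rightarrow> (real \<Rightarrow> real) \<Rightarrow> (nat \<Rightarrow> real mat \<Rightarrow> nat \<Rightarrow> real ^ 'd) \<Rightarrow> bool" where
  "restricted_mle K G Zhat \<longleftrightarrow>
     (\<forall>n\<ge>1. \<forall>y\<in>adjacency_matrices n.
        is_arg_max (log_likelihood K n y) (\<lambda>z. \<forall>i<n. norm (z i) \<le> G (real n)) (Zhat n y))"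

subsection \<open>Distinctly bunched eigenvalues\<close>

definition centering_matrix :: "nat \<Rightarrow> real mat" where
  "centering_matrix n = 1\<^sub>m n - (1 / real n) \<cdot>\<^sub>m mat n n (\<lambda>_. 1)"

text \<open>The entries of \<open>Z Z\<^sup>T\<close> are the inner products of the rows of \<open>Z\<close>.\<close>

definition centered_gram :: "nat \<Rightarrow> (nat \<Rightarrow> real ^ 'd) \<Rightarrow> real mat" where
  "centered_gram n z =
     centering_matrix n * mat n n (\<lambda>(i, j). inner (z i) (z j)) * centering_matrix n"

text \<open>Nonzero eigenvalues in decreasing order, repeated according to multiplicity.  A real
  symmetric matrix has only real eigenvalues, so none is lost by taking real roots.\<close>

definition nonzero_eigenvalues :: "real mat \<Rightarrow> real list" where
  "nonzero_eigenvalues A =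
     rev (sorted_list_of_multiset (filter_mset (\<lambda>x. x \<noteq> 0) (proots (char_poly A))))"

text \<open>\<open>\<lambda>\<^sub>j\<close> for \<open>1 \<le> j \<le> d\<close>, provided there are \<open>d\<close> nonzero eigenvalues, and \<open>\<lambda>\<^bsub>d+1\<^esub> = 0\<close>.\<close>

definition lam :: "nat \<Rightarrow> (nat \<Rightarrow> real ^ 'd) \<Rightarrow> nat \<Rightarrow> real" where
  "lam n z j =
     (if 1 \<le> j \<and> j \<le> CARD('d) then nonzero_eigenvalues (centered_gram n z) ! (j - 1) else 0)"

definition distinctly_bunched ::
  "(nat \<Rightarrow> 'w measure) \<Rightarrow> (nat \<Rightarrow> 'w \<Rightarrow> nat \<Rightarrow> real ^ 'd) \<Rightarrow>
   (nat \<Rightarrow> real) \<Rightarrow> (nat \<Rightarrow> real) \<Rightarrow> bool" where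
  "distinctly_bunched M Z a b \<longleftrightarrow>
     (\<exists>k\<in>{1..CARD('d)}. \<exists>i :: nat \<Rightarrow> nat.
        i 1 = 1 \<and> (\<forall>j\<in>{1..k}. i j < i (j + 1)) \<and> i (k + 1) = CARD('d) + 1 \<and>
        (\<forall>n>CARD('d). AE \<omega> in M n.
           length (nonzero_eigenvalues (centered_gram n (Z n \<omega>))) = CARD('d) \<and>
           (\<forall>j\<in>{1..k}.
              (lam n (Z n \<omega>) (i (j + 1) - 1) - lam n (Z n \<omega>) (i j))\<^sup>2
                / lam n (Z n \<omega>) (i (j + 1) - 1) \<le> a n \<and>
              (lam n (Z n \<omega>) (i (j + 1) - 1) - lam n (Z n \<omega>) (i (j + 1)))\<^sup>2
                / lam n (Z n \<omega>) (i j) \<ge> b n)))"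

subsection \<open>The error bound\<close>

text \<open>Quotients and products of nonnegative quantities, where a zero denominator or an infinite
  factor makes the result infinite.  Thus \<open>0 / 0 = \<infinity>\<close> and \<open>0 * \<infinity> = \<infinity>\<close>, unlike in \<open>ennreal\<close>: otherwise
  a constant \<open>K\<close> would get the bound \<open>3 (d - 1) a n\<close>.\<close>

definition ext_quot :: "real \<Rightarrow> real \<Rightarrow> ennreal" where
  "ext_quot p q = (if q = 0 then \<infinity> else ennreal (p / q))"

definition ext_prod :: "ennreal \<Rightarrow> ennreal \<Rightarrow> ennreal" where
  "ext_prod p q = (if p = \<infinity> \<or> q = \<infinity> then \<infinity> else p * q)"

definition alpha_K :: "(real \<Rightarrow> real) \<Rightarrow> real \<Rightarrow> (real \<Rightarrow> real) \<Rightarrow> nat \<Rightarrow> ennreal" where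
  "alpha_K K \<epsilon> G n =
     (SUP x\<in>{0<..2 * G (real n)}. ext_quot \<bar>deriv K x\<bar> (\<bar>x\<bar> * K x * \<epsilon>))"

definition beta_K :: "(real \<Rightarrow> real) \<Rightarrow> (real \<Rightarrow> real) \<Rightarrow> nat \<Rightarrow> ennreal" where
  "beta_K K G n = (SUP x\<in>{0<..2 * G (real n)}. ext_quot (x\<^sup>2 * K x) ((deriv K x)\<^sup>2))"

definition frobenius_norm :: "nat \<Rightarrow> (nat \<Rightarrow> real ^ 'd) \<Rightarrow> real" where
  "frobenius_norm n z = sqrt (\<Sum>i<n. \<Sum>k\<in>UNIV. (z i $ k)\<^sup>2)"

definition identical_rows :: "nat \<Rightarrow> (nat \<Rightarrow> real ^ 'd) set" where
  "identical_rows n = {q. \<forall>i<n. \<forall>j<n. q i = q j}"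

text \<open>Row \<open>i\<close> of the product of \<open>z\<close> and \<open>U\<close> is \<open>z i v* U\<close>.\<close>

definition procrustes_error :: "nat \<Rightarrow> (nat \<Rightarrow> real ^ 'd) \<Rightarrow> (nat \<Rightarrow> real ^ 'd) \<Rightarrow> real" where
  "procrustes_error n zhat z =
     (INF (U, q)\<in>{U :: real ^ 'd ^ 'd. orthogonal_matrix U} \<times> identical_rows n.
        (frobenius_norm n (\<lambda>i. zhat i v* U - z i - q i))\<^sup>2)"

end

theory Submission
  imports Defs
begin

text \<open>
  Three estimates are combined.

  \<^item> Linear algebra.  The centered Gram matrix of a configuration depends linearly on its matrix of
    squared distances, and the squared distance of two configurations up to rigid motions is at most
    \<open>2 / \<lambda>\<^sub>d\<close> times the squared Frobenius distance of their centered Gram matrices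
    (\<open>procrustes_bound\<close>).  The smallest nonzero eigenvalue \<open>\<lambda>\<^sub>d\<close> of the true Gram matrix is at
    least \<open>b n\<close>, by the bunching condition for the last bunch.  So it suffices to estimate the
    squared distances well.

  \<^item> The likelihood.  Since the estimator is at least as likely as the truth, the sum of the
    Kullback-Leibler divergences between the true and the estimated link probabilities is at most a
    fluctuation \<open>\<Sum> (Y - p) (h(zhat) - h(z))\<close>, where \<open>h\<close> is the logit of the link function.
    The divergences dominate squared Hellinger distances, which by the definition of \<open>\<beta>\<close>
    dominate \<open>1 / (16 \<beta>)\<close> times the squared error in the squared distances.

  \<^item> The fluctuation.  By the definition of \<open>\<alpha>\<close>, the logit is \<open>\<alpha> / 2\<close>-Lipschitz in the squared
    distance, so conditionally on the positions the fluctuation has sub-Gaussian increments in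
    \<open>zhat\<close>.  Chaining over dyadic nets of the product of \<open>n\<close> balls of radius \<open>G\<close> in dimension \<open>d\<close>
    bounds its supremum by a multiple of \<open>d \<alpha> G\<^sup>2 n\<^sup>3\<^sup>/\<^sup>2\<close> outside an event of probability at most
    \<open>2 n exp(-n)\<close> (\<open>chaining_event\<close>, \<open>chaining_bound\<close>).  As the nets do not depend on the data,
    no measurability of suprema is needed.

  Multiplying the three bounds gives \<open>2304 d \<alpha> \<beta> G\<^sup>2 n\<^sup>3\<^sup>/\<^sup>2 / b\<close>, below the claimed threshold.
  For \<open>n \<le> d\<close> the claim holds by the choice of the constant.
\<close>

no_notation Matrix.scalar_prod (infix "\<bullet>" 70)
notation Matrix.vec_index (infixl "$v" 100)

section \<open>Orthogonal alignment of two configurations\<close>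

lemma compact_orthogonal_matrices: "compact {U :: real ^ 'd ^ 'd. orthogonal_matrix U}"
proof -
  let ?f = "\<lambda>U :: real ^ 'd ^ 'd. transpose U ** U"
  have "norm U \<le> real CARD('d)" if "orthogonal_matrix U"
    for U :: "real ^ 'd ^ 'd"
  proof -
    have row: "norm (Finite_Cartesian_Product.row i U) = 1" for i
      using that by (simp add: orthogonal_matrix_orthonormal_rows)
    have "norm U \<le> (\<Sum>i\<in>UNIV. norm (U $ i))"
      by (simp add: norm_vec_def L2_set_le_sum)
    also have "\<dots> = real CARD('d)"
      using row by (simp add: Finite_Cartesian_Product.row_def vec_lambda_eta)
    finally show ?thesis .
  qed
  then have "bounded {U :: real ^ 'd ^ 'd. orthogonal_matrix U}"
    by (intro boundedI) blast
  moreover have "continuous_on UNIV ?f"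
    unfolding matrix_matrix_mult_def transpose_def
    by (intro continuous_intros)
  then have "closed (?f -` {Finite_Cartesian_Product.mat 1})"
    by (intro closed_vimage) (auto)
  then have "closed {U :: real ^ 'd ^ 'd. orthogonal_matrix U}"
    by (simp add: orthogonal_matrix vimage_def)
  ultimately show ?thesis by (simp add: compact_eq_bounded_closed)
qed

text \<open>The sum is the squared Frobenius norm of \<open>\<Sum>\<^sub>i g\<^sub>i f\<^sub>i\<^sup>T\<close>, written with Gram matrices only.\<close>

lemma sum_inner_mult_inner_nonneg:
  fixes f g :: "'i \<Rightarrow> 'a::euclidean_space"
  shows "0 \<le> (\<Sum>i\<in>I. \<Sum>j\<in>I. (g i \<bullet> g j) * (f i \<bullet> f j))"
proof -
  have "(\<Sum>i\<in>I. \<Sum>j\<in>I. (g i \<bullet> g j) * (f i \<bullet> f j)) =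
      (\<Sum>i\<in>I. \<Sum>j\<in>I. \<Sum>k\<in>Basis. \<Sum>l\<in>Basis.
        ((g i \<bullet> k) * (f i \<bullet> l)) * ((g j \<bullet> k) * (f j \<bullet> l)))"
  proof (intro sum.cong refl)
    fix i j
    show "(g i \<bullet> g j) * (f i \<bullet> f j) = (\<Sum>k\<in>Basis. \<Sum>l\<in>Basis.
        ((g i \<bullet> k) * (f i \<bullet> l)) * ((g j \<bullet> k) * (f j \<bullet> l)))"
      unfolding euclidean_inner[of "g i" "g j"] euclidean_inner[of "f i" "f j"] sum_product
      by (intro sum.cong refl) (simp only: mult_ac)
  qed
  also have "\<dots> = (\<Sum>k\<in>Basis. \<Sum>l\<in>Basis. \<Sum>i\<in>I. \<Sum>j\<in>I.
        ((g i \<bullet> k) * (f i \<bullet> l)) * ((g j \<bullet> k) * (f j \<bullet> l)))"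
    by (simp only: sum.swap[of _ Basis I])
  also have "\<dots> = (\<Sum>k\<in>Basis. \<Sum>l\<in>Basis. (\<Sum>i\<in>I. (g i \<bullet> k) * (f i \<bullet> l))\<^sup>2)"
    by (simp add: power2_eq_square sum_product)
  also have "\<dots> \<ge> 0" by (intro sum_nonneg) auto
  finally show ?thesis .
qed

lemma linear_le_quadratic_imp_zero:
  fixes c e :: real
  assumes "\<And>t. t * c \<le> t\<^sup>2 * e"
  shows "c = 0"
proof (rule ccontr)
  assume "c \<noteq> 0"
  define t where "t = c / (1 + \<bar>e\<bar>)"
  have "t * c \<le> t\<^sup>2 * e" by (fact assms)
  also have "\<dots> \<le> t\<^sup>2 * \<bar>e\<bar>" by (intro mult_left_mono) auto
  finally have "t * c \<le> t\<^sup>2 * \<bar>e\<bar>" .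
  moreover have "t * c = t\<^sup>2 * (1 + \<bar>e\<bar>)"
    by (auto simp: t_def power2_eq_square divide_simps)
  moreover have "t\<^sup>2 > 0" using \<open>c \<noteq> 0\<close> by (auto simp: t_def)
  ultimately show False by (simp add: algebra_simps)
qed

definition reflect :: "'a::real_inner \<Rightarrow> 'a \<Rightarrow> 'a" where
  "reflect v x = x - (2 * (x \<bullet> v) / (v \<bullet> v)) *\<^sub>R v"

lemma orthogonal_transformation_reflect: "orthogonal_transformation (reflect v)"
  unfolding orthogonal_transformation_def
proof (intro conjI allI)
  show "linear (reflect v)"
  proof (rule linearI)
    fix x y and c :: real
    have add: "2 * ((x + y) \<bullet> v) / (v \<bullet> v) = 2 * (x \<bullet> v) / (v \<bullet> v) + 2 * (y \<bullet> v) / (v \<bullet> v)"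
      by (simp add: inner_add_left add_divide_distrib)
    show "reflect v (x + y) = reflect v x + reflect v y"
      unfolding reflect_def add scaleR_add_left by (rule add_diff_add)
    have scale: "2 * ((c *\<^sub>R x) \<bullet> v) / (v \<bullet> v) = c * (2 * (x \<bullet> v) / (v \<bullet> v))" by simp
    show "reflect v (c *\<^sub>R x) = c *\<^sub>R reflect v x"
      unfolding reflect_def scale scaleR_diff_right scaleR_scaleR ..
  qed
  fix x y
  show "reflect v x \<bullet> reflect v y = x \<bullet> y"
  proof (cases "v = 0")
    case False
    define p q where "p = 2 * (x \<bullet> v) / (v \<bullet> v)" and "q = 2 * (y \<bullet> v) / (v \<bullet> v)"
    have "reflect v x \<bullet> reflect v y = x \<bullet> y - q * (x \<bullet> v) - p * (y \<bullet> v) + p * (q * (v \<bullet> v))"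
      unfolding reflect_def p_def[symmetric] q_def[symmetric]
      by (simp add: inner_diff_left inner_diff_right right_diff_distrib inner_commute[of v x] inner_commute[of v y])
    also have "q * (v \<bullet> v) = 2 * (y \<bullet> v)" using False by (simp add: q_def)
    also have "q * (x \<bullet> v) = p * (y \<bullet> v)" by (simp add: p_def q_def)
    finally show ?thesis by simp
  qed (simp add: reflect_def)
qed

text \<open>A polar decomposition of \<open>\<Sum>\<^sub>i a\<^sub>i b\<^sub>i\<^sup>T\<close>, phrased for the bilinear form
  \<open>m(v, w) = \<Sum>\<^sub>i (a\<^sub>i \<bullet> v) (b\<^sub>i U \<bullet> w)\<close>.  Take \<open>U\<close> maximizing \<open>\<Sum>\<^sub>i a\<^sub>i \<bullet> b\<^sub>i U\<close>
  over the compact orthogonal group.  Composing with one reflection cannot increase the maximum,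
  which says that \<open>m\<close> is positive semidefinite; composing with two reflections along \<open>v\<close> and
  \<open>v + t w\<close> cannot either, and letting \<open>t\<close> tend to \<open>0\<close> from both sides gives symmetry.\<close>

lemma exists_aligning_orthogonal_matrix:
  fixes a b :: "'i \<Rightarrow> real ^ 'd"
  obtains U :: "real ^ 'd ^ 'd" where "orthogonal_matrix U"
    "\<And>v w. (\<Sum>i\<in>I. (a i \<bullet> v) * ((b i v* U) \<bullet> w)) = (\<Sum>i\<in>I. (a i \<bullet> w) * ((b i v* U) \<bullet> v))"
    "\<And>v. 0 \<le> (\<Sum>i\<in>I. (a i \<bullet> v) * ((b i v* U) \<bullet> v))"
proof -
  define F where "F U = (\<Sum>i\<in>I. a i \<bullet> (b i v* U))" for U :: "real ^ 'd ^ 'd"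
  have "continuous_on {U. orthogonal_matrix U} F"
    unfolding F_def vector_matrix_mult_def inner_vec_def by (intro continuous_intros)
  moreover have "{U :: real ^ 'd ^ 'd. orthogonal_matrix U} \<noteq> {}"
    using orthogonal_matrix_id by blast
  ultimately obtain U where U: "orthogonal_matrix U"
    and max: "\<And>V. orthogonal_matrix V \<Longrightarrow> F V \<le> F U"
    using continuous_attains_sup[OF compact_orthogonal_matrices, of F] by auto
  define u where "u i = b i v* U" for i
  define m where "m v w = (\<Sum>i\<in>I. (a i \<bullet> v) * (u i \<bullet> w))" for v w
  have max': "(\<Sum>i\<in>I. a i \<bullet> T (u i)) \<le> (\<Sum>i\<in>I. a i \<bullet> u i)" if T: "orthogonal_transformation T" for T
  proof -
    let ?V = "U ** transpose (matrix T)"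
    have "orthogonal_matrix ?V"
      using U T by (simp add: orthogonal_matrix_mul orthogonal_transformation_matrix
          orthogonal_matrix_transpose)
    moreover have "b i v* ?V = T (u i)" for i
    proof -
      have "b i v* ?V = u i v* transpose (matrix T)"
        by (simp only: u_def vector_matrix_mul_assoc)
      also have "\<dots> = matrix T *v u i" by simp
      also have "\<dots> = T (u i)"
        using T by (simp add: orthogonal_transformation_def matrix_works)
      finally show ?thesis .
    qed
    ultimately show ?thesis using max[of ?V] by (simp add: F_def u_def)
  qed
  have m1: "m v w = (\<Sum>i\<in>I. (a i \<bullet> v) * (u i \<bullet> w))" for v w by (fact m_def)
  have nonneg: "0 \<le> m v v" for v
  proof (cases "v = 0")
    case False
    have "(\<Sum>i\<in>I. a i \<bullet> reflect v (u i)) = (\<Sum>i\<in>I. a i \<bullet> u i) - 2 / (v \<bullet> v) * m v v"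
      by (simp add: reflect_def m_def inner_diff sum_subtractf sum_distrib_left mult_ac)
    with max'[OF orthogonal_transformation_reflect, of v] have "0 \<le> 2 / (v \<bullet> v) * m v v" by simp
    moreover have "0 < 2 / (v \<bullet> v)" using False by simp
    ultimately show ?thesis using zero_le_mult_iff[of "2 / (v \<bullet> v)" "m v v"] by (smt (verit))
  qed (simp add: m_def)
  \<comment> \<open>Maximality against the composition of the reflections along \<open>v\<close> and \<open>w\<close>.\<close>
  have two: "2 * (v \<bullet> w) * m w v \<le> m v v * (w \<bullet> w) + m w w * (v \<bullet> v)" for v w
  proof (cases "v = 0 \<or> w = 0")
    case False
    let ?R = "\<lambda>x. reflect w (reflect v x)"
    have "a i \<bullet> ?R (u i) = a i \<bullet> u i - 2 / (v \<bullet> v) * ((a i \<bullet> v) * (u i \<bullet> v))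
        - 2 / (w \<bullet> w) * ((a i \<bullet> w) * (u i \<bullet> w))
        + 4 * (v \<bullet> w) / ((v \<bullet> v) * (w \<bullet> w)) * ((a i \<bullet> w) * (u i \<bullet> v))" for i
    proof -
      define p where "p = 2 * (u i \<bullet> v) / (v \<bullet> v)"
      have "a i \<bullet> ?R (u i) = a i \<bullet> u i - p * (a i \<bullet> v)
          - (2 * (u i \<bullet> w - p * (v \<bullet> w)) / (w \<bullet> w)) * (a i \<bullet> w)"
        by (simp add: reflect_def p_def[symmetric] inner_diff_left inner_diff_right)
      also have "(2 * (u i \<bullet> w - p * (v \<bullet> w)) / (w \<bullet> w)) * (a i \<bullet> w)
          = 2 / (w \<bullet> w) * ((a i \<bullet> w) * (u i \<bullet> w)) - 2 * p * (v \<bullet> w) / (w \<bullet> w) * (a i \<bullet> w)"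
        by (simp add: left_diff_distrib right_diff_distrib diff_divide_distrib mult_ac)
      finally show ?thesis by (simp add: p_def mult_ac)
    qed
    then have "(\<Sum>i\<in>I. a i \<bullet> ?R (u i)) = (\<Sum>i\<in>I. a i \<bullet> u i) - 2 / (v \<bullet> v) * m v v
        - 2 / (w \<bullet> w) * m w w + 4 * (v \<bullet> w) / ((v \<bullet> v) * (w \<bullet> w)) * m w v"
      by (simp add: m_def sum.distrib sum_subtractf sum_distrib_left)
    moreover have "orthogonal_transformation ?R"
      using orthogonal_transformation_compose[OF orthogonal_transformation_reflect
          orthogonal_transformation_reflect, of w v] by (simp add: comp_def)
    ultimately have "4 * (v \<bullet> w) / ((v \<bullet> v) * (w \<bullet> w)) * m w v
        \<le> 2 / (v \<bullet> v) * m v v + 2 / (w \<bullet> w) * m w w"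
      using max'[of ?R] by simp
    moreover have "0 < (v \<bullet> v) * (w \<bullet> w)" using False by simp
    ultimately have "((v \<bullet> v) * (w \<bullet> w)) * (4 * (v \<bullet> w) / ((v \<bullet> v) * (w \<bullet> w)) * m w v)
        \<le> ((v \<bullet> v) * (w \<bullet> w)) * (2 / (v \<bullet> v) * m v v + 2 / (w \<bullet> w) * m w w)"
      by (intro mult_left_mono) auto
    then show ?thesis using False by (simp add: distrib_left mult_ac)
  qed (auto simp: m_def)
  have sym: "m v w = m w v" for v w
  proof (cases "v = 0")
    case False
    have "t * ((v \<bullet> v) * (m w v - m v w)) \<le> t\<^sup>2 *
        (m v v * (w \<bullet> w) + m w w * (v \<bullet> v) - 2 * (v \<bullet> w) * m w v)" for t
    proof -
      have add: "m (x + t *\<^sub>R y) z = m x z + t * m y z" "m z (x + t *\<^sub>R y) = m z x + t * m z y" for x y z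
        by (simp_all add: m_def algebra_simps inner_add sum.distrib sum_distrib_left)
      have "2 * (v \<bullet> (v + t *\<^sub>R w)) * m (v + t *\<^sub>R w) v
          \<le> m v v * ((v + t *\<^sub>R w) \<bullet> (v + t *\<^sub>R w)) + m (v + t *\<^sub>R w) (v + t *\<^sub>R w) * (v \<bullet> v)"
        by (fact two)
      then show ?thesis
        by (simp add: add inner_add inner_commute[of w v] algebra_simps power2_eq_square)
    qed
    from linear_le_quadratic_imp_zero[OF this] show ?thesis using False by simp
  qed (simp add: m_def)
  show thesis
    by (rule that[OF U]) (use sym nonneg in \<open>simp_all add: m_def u_def\<close>)
qed

text \<open>With \<open>U\<close> aligned and \<open>D\<^sub>i = b\<^sub>i U - a\<^sub>i\<close>, the difference of the Gram matrices is
  \<open>A D\<^sup>T + D A\<^sup>T + D D\<^sup>T\<close>.  Its squared norm expands into traces; symmetry of \<open>A\<^sup>T D\<close> allows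
  a square \<open>tr((D\<^sup>T D + c A\<^sup>T D)\<^sup>2)\<close> to be split off, and positivity of \<open>A\<^sup>T (A + D)\<close> bounds the
  remaining cubic term from below.  What is left is a multiple of \<open>tr(A\<^sup>T A D\<^sup>T D)\<close>, which the
  smallest eigenvalue of \<open>A\<^sup>T A\<close> controls.\<close>

lemma procrustes_bound:
  fixes a b :: "'i \<Rightarrow> real ^ 'd"
  assumes ray: "\<And>v. (\<Sum>i\<in>I. (a i \<bullet> v)\<^sup>2) \<ge> \<mu> * (v \<bullet> v)"
  obtains U :: "real ^ 'd ^ 'd" where "orthogonal_matrix U"
    "\<mu> * (\<Sum>i\<in>I. (norm (b i v* U - a i))\<^sup>2) \<le> 2 * (\<Sum>i\<in>I. \<Sum>j\<in>I. (b i \<bullet> b j - a i \<bullet> a j)\<^sup>2)"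
proof -
  obtain U :: "real ^ 'd ^ 'd" where U: "orthogonal_matrix U"
    and sym: "\<And>v w. (\<Sum>i\<in>I. (a i \<bullet> v) * ((b i v* U) \<bullet> w)) = (\<Sum>i\<in>I. (a i \<bullet> w) * ((b i v* U) \<bullet> v))"
    and psd: "\<And>v. 0 \<le> (\<Sum>i\<in>I. (a i \<bullet> v) * ((b i v* U) \<bullet> v))"
    using exists_aligning_orthogonal_matrix[where a = a and b = b and I = I] by blast
  define D where "D i = b i v* U - a i" for i
  have bU: "b i v* U = a i + D i" for i by (simp add: D_def)
  have sym': "(\<Sum>i\<in>I. (a i \<bullet> v) * (D i \<bullet> w)) = (\<Sum>i\<in>I. (a i \<bullet> w) * (D i \<bullet> v))" for v w
    using sym[of v w] by (simp add: bU inner_add distrib_left sum.distrib mult.commute)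
  have inner_eq: "b i \<bullet> b j = (a i + D i) \<bullet> (a j + D j)" for i j
  proof -
    have "orthogonal_transformation ((*v) (transpose U))"
      using U orthogonal_matrix_transpose
      by (simp add: orthogonal_transformation_matrix matrix_vector_mul_linear)
    then show ?thesis
      unfolding bU[symmetric] orthogonal_transformation_def by simp
  qed
  define P where "P = (\<Sum>i\<in>I. \<Sum>j\<in>I. (a i \<bullet> D j)\<^sup>2)"
  define Q where "Q = (\<Sum>i\<in>I. \<Sum>j\<in>I. (D i \<bullet> D j)\<^sup>2)"
  define R where "R = (\<Sum>i\<in>I. \<Sum>j\<in>I. (a i \<bullet> a j) * (D i \<bullet> D j))"
  define W where "W = (\<Sum>i\<in>I. \<Sum>j\<in>I. (a i \<bullet> D j) * (D i \<bullet> D j))"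
  have swap: "(\<Sum>i\<in>I. \<Sum>j\<in>I. f i j) = (\<Sum>i\<in>I. \<Sum>j\<in>I. f j i)" for f :: "'i \<Rightarrow> 'i \<Rightarrow> real"
    by (rule sum.swap)
  have R': "(\<Sum>i\<in>I. \<Sum>j\<in>I. (a i \<bullet> D j) * (D i \<bullet> a j)) = R"
  proof -
    have "(\<Sum>i\<in>I. \<Sum>j\<in>I. (a i \<bullet> D j) * (D i \<bullet> a j)) = (\<Sum>j\<in>I. \<Sum>i\<in>I. (a i \<bullet> D j) * (D i \<bullet> a j))"
      by (rule sum.swap)
    also have "\<dots> = (\<Sum>j\<in>I. \<Sum>i\<in>I. (a i \<bullet> a j) * (D i \<bullet> D j))"
      by (intro sum.cong refl sym')
    also have "\<dots> = R" unfolding R_def by (rule sum.swap)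
    finally show ?thesis .
  qed
  have P': "(\<Sum>i\<in>I. \<Sum>j\<in>I. (D i \<bullet> a j)\<^sup>2) = P"
    unfolding P_def by (subst swap) (simp add: inner_commute)
  have W': "(\<Sum>i\<in>I. \<Sum>j\<in>I. (D i \<bullet> a j) * (D i \<bullet> D j)) = W"
    unfolding W_def by (subst swap) (simp add: inner_commute)
  have "(\<Sum>i\<in>I. \<Sum>j\<in>I. (b i \<bullet> b j - a i \<bullet> a j)\<^sup>2) =
      (\<Sum>i\<in>I. \<Sum>j\<in>I. (a i \<bullet> D j)\<^sup>2 + (D i \<bullet> a j)\<^sup>2 + (D i \<bullet> D j)\<^sup>2 + 2 * ((a i \<bullet> D j) * (D i \<bullet> a j))
        + 2 * ((a i \<bullet> D j) * (D i \<bullet> D j)) + 2 * ((D i \<bullet> a j) * (D i \<bullet> D j)))"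
    by (intro sum.cong refl) (simp add: inner_eq inner_add power2_eq_square algebra_simps)
  also have "\<dots> = 2 * P + Q + 2 * R + 4 * W"
    by (simp add: sum.distrib sum_distrib_left[symmetric] P' W' R' P_def[symmetric] Q_def[symmetric] W_def[symmetric])
  finally have total: "(\<Sum>i\<in>I. \<Sum>j\<in>I. (b i \<bullet> b j - a i \<bullet> a j)\<^sup>2) = 2 * P + Q + 2 * R + 4 * W" .
  \<comment> \<open>Any \<open>c > 1\<close> with \<open>c\<^sup>2 \<le> 2\<close> works; the resulting factor is \<open>1 / (2 c - 2)\<close>, here \<open>2\<close>.\<close>
  define c :: real where "c = 5 / 4"
  have "0 \<le> (\<Sum>i\<in>I. \<Sum>j\<in>I. ((D i + c *\<^sub>R a i) \<bullet> (D j + c *\<^sub>R a j)) * (D i \<bullet> D j))"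
    by (rule sum_inner_mult_inner_nonneg)
  also have "\<dots> = (\<Sum>i\<in>I. \<Sum>j\<in>I. (D i \<bullet> D j)\<^sup>2 + c * ((a i \<bullet> D j) * (D i \<bullet> D j))
      + c * ((D i \<bullet> a j) * (D i \<bullet> D j)) + c\<^sup>2 * ((a i \<bullet> a j) * (D i \<bullet> D j)))"
    by (intro sum.cong refl) (simp add: inner_add power2_eq_square algebra_simps)
  also have "\<dots> = Q + 2 * c * W + c\<^sup>2 * R"
    by (simp add: sum.distrib sum_distrib_left[symmetric] W' R' Q_def[symmetric] W_def[symmetric]
        R_def[symmetric])
  finally have sq: "0 \<le> Q + (5/2) * W + (25/16) * R" by (simp add: c_def power2_eq_square)
  have R0: "0 \<le> R" unfolding R_def by (rule sum_inner_mult_inner_nonneg)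
  have PW: "0 \<le> P + W"
  proof -
    have "0 \<le> (\<Sum>j\<in>I. \<Sum>i\<in>I. (a i \<bullet> D j) * ((a i + D i) \<bullet> D j))"
    proof (rule sum_nonneg)
      fix j
      show "0 \<le> (\<Sum>i\<in>I. (a i \<bullet> D j) * ((a i + D i) \<bullet> D j))"
        using psd[of "D j"] unfolding bU .
    qed
    also have "\<dots> = (\<Sum>i\<in>I. \<Sum>j\<in>I. (a i \<bullet> D j) * ((a i + D i) \<bullet> D j))" by (rule sum.swap)
    also have "\<dots> = P + W"
      by (simp add: P_def W_def inner_add distrib_left sum.distrib power2_eq_square)
    finally show ?thesis .
  qed
  have "\<mu> * (\<Sum>i\<in>I. (norm (D i))\<^sup>2) = (\<Sum>i\<in>I. \<mu> * (D i \<bullet> D i))"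
    by (simp add: sum_distrib_left power2_norm_eq_inner)
  also have "\<dots> \<le> (\<Sum>j\<in>I. \<Sum>i\<in>I. (a i \<bullet> D j)\<^sup>2)"
    by (intro sum_mono ray)
  also have "\<dots> = P" unfolding P_def by (rule sum.swap)
  finally have "\<mu> * (\<Sum>i\<in>I. (norm (D i))\<^sup>2) \<le> P" .
  with total sq R0 PW have
    "\<mu> * (\<Sum>i\<in>I. (norm (D i))\<^sup>2) \<le> 2 * (\<Sum>i\<in>I. \<Sum>j\<in>I. (b i \<bullet> b j - a i \<bullet> a j)\<^sup>2)"
    by linarith
  with U show thesis by (intro that[of U]) (simp_all add: D_def)
qed

section \<open>Centered Gram matrices and distance matrices\<close>

lemma sum_square_minus_mean_le:
  fixes x :: "nat \<Rightarrow> real"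
  shows "(\<Sum>i<n. (x i - (\<Sum>k<n. x k) / real n)\<^sup>2) \<le> (\<Sum>i<n. (x i)\<^sup>2)"
proof (cases "n = 0")
  case False
  define m where "m = (\<Sum>k<n. x k) / real n"
  have "(\<Sum>i<n. (x i - m)\<^sup>2) = (\<Sum>i<n. (x i)\<^sup>2) - 2 * m * (\<Sum>i<n. x i) + real n * m\<^sup>2"
    by (simp add: power2_diff sum.distrib sum_subtractf sum_distrib_left mult_ac)
  also have "(\<Sum>i<n. x i) = real n * m" using False by (simp add: m_def)
  also have "(\<Sum>i<n. (x i)\<^sup>2) - 2 * m * (real n * m) + real n * m\<^sup>2
      = (\<Sum>i<n. (x i)\<^sup>2) - real n * m\<^sup>2"
    by (simp add: power2_eq_square)
  finally show ?thesis unfolding m_def[symmetric] by simp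
qed simp

definition centered :: "nat \<Rightarrow> (nat \<Rightarrow> real ^ 'd) \<Rightarrow> nat \<Rightarrow> real ^ 'd" where
  "centered n z i = z i - (1 / real n) *\<^sub>R (\<Sum>k<n. z k)"

lemma sum_centered: "n > 0 \<Longrightarrow> (\<Sum>i<n. centered n z i) = 0"
  by (simp add: centered_def sum_subtractf sum_constant_scaleR del: sum_constant)

text \<open>Classical multidimensional scaling: centering the rows and columns of the matrix of squared
  distances and dividing by \<open>-2\<close> recovers the centered Gram matrix.\<close>

lemma inner_centered_eq:
  fixes z :: "nat \<Rightarrow> real ^ 'd"
  assumes "n > 0"
  defines "D \<equiv> \<lambda>i j. (norm (z i - z j))\<^sup>2"
  defines "r \<equiv> \<lambda>i j. D i j - (\<Sum>k<n. D i k) / real n"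
  shows "centered n z i \<bullet> centered n z j = - (r i j - (\<Sum>k<n. r k j) / real n) / 2"
proof -
  let ?a = "centered n z"
  define s where "s = (\<Sum>k<n. ?a k \<bullet> ?a k) / real n"
  have D: "D i j = ?a i \<bullet> ?a i + ?a j \<bullet> ?a j - 2 * (?a i \<bullet> ?a j)" for i j
  proof -
    have "z i - z j = ?a i - ?a j" by (simp add: centered_def)
    then show ?thesis
      unfolding D_def power2_norm_eq_inner by (simp only: inner_diff) (simp add: inner_commute)
  qed
  have "(\<Sum>k<n. ?a i \<bullet> ?a k) = 0" "(\<Sum>k<n. ?a k \<bullet> ?a i) = 0" for i
    by (simp_all add: inner_sum_right[symmetric] inner_sum_left[symmetric] sum_centered assms)
  note z = this
  have r: "r i j = ?a j \<bullet> ?a j - 2 * (?a i \<bullet> ?a j) - s" for i j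
  proof -
    have "(\<Sum>k<n. D i k) = real n * (?a i \<bullet> ?a i) + real n * s"
      using assms(1) by (simp add: D sum.distrib sum_subtractf sum_distrib_left[symmetric] z s_def)
    then show ?thesis using assms(1) by (simp add: r_def D add_divide_distrib)
  qed
  have "(\<Sum>k<n. r k j) = real n * (?a j \<bullet> ?a j) - real n * s"
    by (simp add: r sum_subtractf sum_distrib_left[symmetric] z)
  then have "(\<Sum>k<n. r k j) / real n = ?a j \<bullet> ?a j - s"
    using assms(1) by (simp add: diff_divide_distrib)
  then show ?thesis by (simp add: r)
qed

text \<open>Double centering is linear and does not increase the Frobenius norm.\<close>

lemma centered_gram_diff_le:
  fixes w z :: "nat \<Rightarrow> real ^ 'd"
  assumes "n > 0"
  shows "4 * (\<Sum>i<n. \<Sum>j<n. (centered n w i \<bullet> centered n w j - centered n z i \<bullet> centered n z j)\<^sup>2)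
    \<le> (\<Sum>i<n. \<Sum>j<n. ((norm (w i - w j))\<^sup>2 - (norm (z i - z j))\<^sup>2)\<^sup>2)"
proof -
  define D where "D i j = (norm (w i - w j))\<^sup>2 - (norm (z i - z j))\<^sup>2" for i j
  define r where "r i j = D i j - (\<Sum>k<n. D i k) / real n" for i j
  have eq: "centered n w i \<bullet> centered n w j - centered n z i \<bullet> centered n z j
      = - (r i j - (\<Sum>k<n. r k j) / real n) / 2" for i j
    unfolding inner_centered_eq[OF assms]
    by (simp add: r_def D_def sum_subtractf diff_divide_distrib sum_divide_distrib)
  have "4 * (\<Sum>i<n. \<Sum>j<n. (centered n w i \<bullet> centered n w j - centered n z i \<bullet> centered n z j)\<^sup>2)
      = (\<Sum>i<n. \<Sum>j<n. (r i j - (\<Sum>k<n. r k j) / real n)\<^sup>2)"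
    by (simp add: eq sum_distrib_left power_divide power2_commute)
  also have "\<dots> = (\<Sum>j<n. \<Sum>i<n. (r i j - (\<Sum>k<n. r k j) / real n)\<^sup>2)" by (rule sum.swap)
  also have "\<dots> \<le> (\<Sum>j<n. \<Sum>i<n. (r i j)\<^sup>2)"
    by (intro sum_mono sum_square_minus_mean_le)
  also have "\<dots> = (\<Sum>i<n. \<Sum>j<n. (r i j)\<^sup>2)" by (rule sum.swap)
  also have "\<dots> \<le> (\<Sum>i<n. \<Sum>j<n. (D i j)\<^sup>2)"
    unfolding r_def by (intro sum_mono sum_square_minus_mean_le)
  finally show ?thesis by (simp add: D_def)
qed


section \<open>The least nonzero eigenvalue of the centered Gram matrix\<close>

text \<open>Sylvester's identity.  With \<open>M = (X I, A; B, I)\<close>, eliminating \<open>B\<close> by column operations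
  gives \<open>det M = det (X I - A B)\<close>, and by row operations
  \<open>X\<^sup>m det M = X\<^sup>n det (X I - B A)\<close>.\<close>

lemma char_poly_mult_swap:
  fixes A B :: "'a::idom mat"
  assumes A: "A \<in> carrier_mat n m" and B: "B \<in> carrier_mat m n"
  shows "[:0, 1:] ^ m * char_poly (A * B) = [:0, 1:] ^ n * char_poly (B * A)"
proof -
  let ?X = "[:0, 1:] :: 'a poly"
  let ?h = "map_mat (\<lambda>a. [:a:])"
  interpret h: inj_comm_ring_hom "\<lambda>a :: 'a. [:a:]" by unfold_locales (auto simp: one_pCons)
  have cA: "?h A \<in> carrier_mat n m" and cB: "?h B \<in> carrier_mat m n" using A B by auto
  let ?M = "four_block_mat (?X \<cdot>\<^sub>m 1\<^sub>m n) (?h A) (?h B) (1\<^sub>m m)"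
  let ?L = "four_block_mat (1\<^sub>m n) (0\<^sub>m n m) (- ?h B) (?X \<cdot>\<^sub>m 1\<^sub>m m)"
  let ?R = "four_block_mat (1\<^sub>m n) (0\<^sub>m n m) (- ?h B) (1\<^sub>m m)"
  have M: "?M \<in> carrier_mat (n + m) (n + m)" and L: "?L \<in> carrier_mat (n + m) (n + m)"
    and R: "?R \<in> carrier_mat (n + m) (n + m)"
    using A B by auto
  have neg_lift: "map_mat (\<lambda>a. [:- a:]) C = - ?h C" for C :: "'a mat"
    by (rule eq_matI) auto
  have cpAB: "char_poly (A * B) = det (?X \<cdot>\<^sub>m 1\<^sub>m n + - (?h A * ?h B))"
  proof -
    have "map_mat (\<lambda>a. [:- a:]) (A * B) = - (?h A * ?h B)"
      unfolding h.mat_hom_mult[OF A B, symmetric] by (rule neg_lift)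
    then show ?thesis using A B by (simp add: char_poly_defs)
  qed
  have cpBA: "char_poly (B * A) = det (?X \<cdot>\<^sub>m 1\<^sub>m m + - (?h B * ?h A))"
  proof -
    have "map_mat (\<lambda>a. [:- a:]) (B * A) = - (?h B * ?h A)"
      unfolding h.mat_hom_mult[OF B A, symmetric] by (rule neg_lift)
    then show ?thesis using A B by (simp add: char_poly_defs)
  qed
  have "?M * ?R = four_block_mat (?X \<cdot>\<^sub>m 1\<^sub>m n + - (?h A * ?h B)) (?h A) (0\<^sub>m m n) (1\<^sub>m m)"
    using cA cB by (subst mult_four_block_mat) auto
  then have "det (?M * ?R) = char_poly (A * B)"
    using cA cB by (simp add: det_four_block_mat_lower_left_zero[of _ n _ m] cpAB)
  moreover have "det (?M * ?R) = det ?M"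
    unfolding det_mult[OF M R] using cB by (simp add: det_four_block_mat_upper_right_zero[of _ n _ m])
  moreover have lower_left: "- ?h B * (?X \<cdot>\<^sub>m 1\<^sub>m n) + ?X \<cdot>\<^sub>m 1\<^sub>m m * ?h B = 0\<^sub>m m n"
    using cB mult_smult_distrib[of "?h B" m n "1\<^sub>m n" n ?X]
      mult_smult_assoc_mat[of "1\<^sub>m m" m m "?h B" n ?X] by simp
  moreover have "?L * ?M = four_block_mat (?X \<cdot>\<^sub>m 1\<^sub>m n) (?h A) (0\<^sub>m m n) (?X \<cdot>\<^sub>m 1\<^sub>m m + - (?h B * ?h A))"
    using cA cB lower_left by (subst mult_four_block_mat) auto
  then have "det (?L * ?M) = ?X ^ n * char_poly (B * A)"
    using cA cB by (simp add: det_four_block_mat_lower_left_zero[of _ n _ m] cpBA det_smult)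
  moreover have "det (?L * ?M) = ?X ^ m * det ?M"
    unfolding det_mult[OF L M] using cB
    by (simp add: det_four_block_mat_upper_right_zero[of _ n _ m] det_smult)
  ultimately show ?thesis by simp
qed

lemma centered_gram_eq:
  assumes "n > 0"
  shows "centered_gram n z = mat n n (\<lambda>(i, j). centered n z i \<bullet> centered n z j)"
proof -
  let ?C = "centering_matrix n" and ?G = "mat n n (\<lambda>(i, j). z i \<bullet> z j)"
  have C: "?C \<in> carrier_mat n n" by (auto simp: centering_matrix_def)
  have Cij: "?C $$ (i, j) = (if i = j then 1 else 0) - 1 / real n" if "i < n" "j < n" for i j
    using that by (simp add: centering_matrix_def)
  have sum_C: "(\<Sum>k<n. ?C $$ (i, k) *\<^sub>R z k) = centered n z i" if "i < n" for i
  proof -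
    have "(\<Sum>k<n. ?C $$ (i, k) *\<^sub>R z k) = (\<Sum>k<n. (if i = k then z k else 0) - (1 / real n) *\<^sub>R z k)"
      using that by (intro sum.cong refl) (auto simp: Cij algebra_simps)
    also have "\<dots> = centered n z i"
      using that by (simp add: sum_subtractf centered_def scaleR_sum_right)
    finally show ?thesis .
  qed
  show ?thesis
  proof (intro eq_matI)
    fix i j assume ij: "i < dim_row (mat n n (\<lambda>(i, j). centered n z i \<bullet> centered n z j))"
      "j < dim_col (mat n n (\<lambda>(i, j). centered n z i \<bullet> centered n z j))"
    then have "centered_gram n z $$ (i, j)
        = (\<Sum>l<n. (\<Sum>k<n. ?C $$ (i, k) * (z k \<bullet> z l)) * ?C $$ (l, j))"
      using C by (simp add: centered_gram_def scalar_prod_def atLeast0LessThan)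
    also have "\<dots> = (\<Sum>l<n. (centered n z i \<bullet> z l) * ?C $$ (l, j))"
      using ij by (simp add: sum_C[symmetric] inner_sum_left)
    also have "\<dots> = (\<Sum>l<n. centered n z i \<bullet> (?C $$ (j, l) *\<^sub>R z l))"
      using ij by (intro sum.cong refl) (auto simp: Cij)
    also have "\<dots> = centered n z i \<bullet> centered n z j"
      using ij by (simp add: sum_C[symmetric] inner_sum_right)
    finally show "centered_gram n z $$ (i, j)
        = mat n n (\<lambda>(i, j). centered n z i \<bullet> centered n z j) $$ (i, j)"
      using ij by simp
  qed (use C in \<open>simp_all add: centered_gram_def\<close>)
qed

text \<open>A minimizer of the quadratic form on the unit sphere is an eigenvector, since the first
  variation of the form minus \<open>\<mu>\<close> times the squared norm vanishes there.\<close>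

lemma rayleigh_quotient_min:
  fixes a :: "'i \<Rightarrow> real ^ 'd"
  obtains v \<mu> where "v \<noteq> 0" "\<And>x. \<mu> * (x \<bullet> x) \<le> (\<Sum>i\<in>I. (a i \<bullet> x)\<^sup>2)"
    "\<And>x. (\<Sum>i\<in>I. (a i \<bullet> v) * (a i \<bullet> x)) = \<mu> * (v \<bullet> x)"
proof -
  define q where "q x = (\<Sum>i\<in>I. (a i \<bullet> x)\<^sup>2)" for x
  have "continuous_on (sphere 0 1) q" unfolding q_def by (intro continuous_intros)
  then obtain v where v: "norm v = 1" and min: "\<And>x. norm x = 1 \<Longrightarrow> q v \<le> q x"
    using continuous_attains_inf[of "sphere 0 1" q] by (auto simp: )
  have ray: "q v * (x \<bullet> x) \<le> q x" for x
  proof (cases "x = 0")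
    case False
    have "q v \<le> q ((1 / norm x) *\<^sub>R x)" using False by (intro min) simp
    also have "\<dots> = q x / (x \<bullet> x)"
      by (simp add: q_def power_divide sum_divide_distrib power2_norm_eq_inner)
    finally show ?thesis using False by (simp add: pos_le_divide_eq)
  qed (simp add: q_def)
  have vv: "v \<bullet> v = 1" using v by (simp add: norm_eq_1)
  have "(\<Sum>i\<in>I. (a i \<bullet> v) * (a i \<bullet> x)) = q v * (v \<bullet> x)" for x
  proof -
    let ?m = "\<Sum>i\<in>I. (a i \<bullet> v) * (a i \<bullet> x)"
    have "t * (2 * (q v * (v \<bullet> x) - ?m)) \<le> t\<^sup>2 * (q x - q v * (x \<bullet> x))" for t
    proof -
      have "q (v + t *\<^sub>R x) = q v + 2 * t * ?m + t\<^sup>2 * q x"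
        by (simp add: q_def inner_add power2_eq_square algebra_simps sum.distrib sum_distrib_left)
      moreover have "q v * ((v + t *\<^sub>R x) \<bullet> (v + t *\<^sub>R x))
          = q v + 2 * t * (q v * (v \<bullet> x)) + t\<^sup>2 * (q v * (x \<bullet> x))"
        by (simp add: inner_add vv inner_commute[of x v] power2_eq_square algebra_simps)
      ultimately show ?thesis using ray[of "v + t *\<^sub>R x"] by (simp add: algebra_simps)
    qed
    from linear_le_quadratic_imp_zero[OF this] show ?thesis by simp
  qed
  with ray v show thesis by (intro that[of v "q v"]) (auto simp: q_def)
qed

lemma order_0_X_power: "order 0 ([:0, 1:] ^ k :: 'a::idom poly) = k"
  using order_power_n_n[of "0::'a" k] by simp

lemma set_nonzero_eigenvalues:
  assumes "A \<in> carrier_mat n n"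
  shows "set (nonzero_eigenvalues A) = {x. x \<noteq> 0 \<and> poly (char_poly A) x = 0}"
proof -
  have "char_poly A \<noteq> 0" using degree_monic_char_poly[OF assms] by auto
  then show ?thesis by (auto simp: nonzero_eigenvalues_def)
qed

lemma length_nonzero_eigenvalues_le:
  fixes A :: "real mat"
  assumes "A \<in> carrier_mat n n"
  shows "length (nonzero_eigenvalues A) + order 0 (char_poly A) \<le> n"
proof -
  let ?p = "char_poly A"
  have p: "?p \<noteq> 0" "degree ?p = n" using degree_monic_char_poly[OF assms] by auto
  have "proots ?p = filter_mset (\<lambda>x. x \<noteq> 0) (proots ?p) + filter_mset (\<lambda>x. \<not> x \<noteq> 0) (proots ?p)"
    by (rule multiset_partition)
  moreover have "size (filter_mset (\<lambda>x. \<not> x \<noteq> 0) (proots ?p)) = order 0 ?p"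
    using p by (simp add: filter_eq_replicate_mset)
  moreover have "size (proots ?p) \<le> n" using size_proots_le[of ?p] p by simp
  moreover have "length (nonzero_eigenvalues A) = size (filter_mset (\<lambda>x. x \<noteq> 0) (proots ?p))"
    by (simp add: nonzero_eigenvalues_def flip: size_mset)
  ultimately show ?thesis by (metis size_union)
qed

lemma sorted_nonzero_eigenvalues: "sorted (rev (nonzero_eigenvalues A))"
  by (simp add: nonzero_eigenvalues_def)

lemma lam_antimono:
  fixes z :: "nat \<Rightarrow> real ^ 'd"
  assumes "length (nonzero_eigenvalues (centered_gram n z)) = CARD('d)" "1 \<le> i" "i \<le> j" "j \<le> CARD('d)"
  shows "lam n z j \<le> lam n z i"
  using assms sorted_rev_nth_mono[OF sorted_nonzero_eigenvalues, of "i - 1" "j - 1" "centered_gram n z"]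
  by (simp add: lam_def)

text \<open>Write the centered Gram matrix as \<open>A A\<^sup>T\<close> with \<open>A\<close> of size \<open>n \<times> d\<close>.  By Sylvester's
  identity the \<open>d \<times> d\<close> matrix \<open>A\<^sup>T A\<close> has the same nonzero eigenvalues with the same
  multiplicities.  There are \<open>d\<close> of them, so \<open>0\<close> is not an eigenvalue of \<open>A\<^sup>T A\<close>, and the
  minimum of its Rayleigh quotient is one of the listed eigenvalues, hence at least \<open>\<lambda>\<^sub>d\<close>.
  It is positive because the Gram matrix is positive semidefinite.\<close>

lemma least_eigenvalue_rayleigh:
  fixes z :: "nat \<Rightarrow> real ^ 'd"
  assumes n: "n > 0" and len: "length (nonzero_eigenvalues (centered_gram n z)) = CARD('d)"
  shows "0 < lam n z CARD('d)"
    and "lam n z CARD('d) * (v \<bullet> v) \<le> (\<Sum>i<n. (centered n z i \<bullet> v)\<^sup>2)"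
proof -
  let ?d = "CARD('d)" and ?a = "centered n z"
  obtain e where e: "bij_betw e {..<?d} (UNIV :: 'd set)"
    using ex_bij_betw_nat_finite[of "UNIV :: 'd set"] by (auto simp: atLeast0LessThan)
  have sum_e: "(\<Sum>k<?d. f (e k)) = (\<Sum>k\<in>UNIV. f k)" for f :: "'d \<Rightarrow> real"
    using sum.reindex_bij_betw[OF e] .
  define A where "A = mat n ?d (\<lambda>(i, k). ?a i $ e k)"
  define B where "B = mat ?d n (\<lambda>(k, i). ?a i $ e k)"
  have A: "A \<in> carrier_mat n ?d" and B: "B \<in> carrier_mat ?d n" by (simp_all add: A_def B_def)
  have AB: "centered_gram n z = A * B"
    by (rule eq_matI) (simp_all add: centered_gram_eq[OF n] A_def B_def scalar_prod_def
        atLeast0LessThan inner_vec_def sum_e[of "\<lambda>k. centered n z _ $ k * centered n z _ $ k"])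
  have carr: "centered_gram n z \<in> carrier_mat n n" using AB A B by simp
  have carr': "B * A \<in> carrier_mat ?d ?d" using A B by simp
  have swap: "[:0, 1:] ^ ?d * char_poly (centered_gram n z) = [:0, 1:] ^ n * char_poly (B * A)"
    unfolding AB by (rule char_poly_mult_swap[OF A B])
  have nz: "char_poly (centered_gram n z) \<noteq> 0" "char_poly (B * A) \<noteq> 0"
    using degree_monic_char_poly[OF carr] degree_monic_char_poly[OF carr'] by auto
  have "?d + order 0 (char_poly (centered_gram n z)) = n + order 0 (char_poly (B * A))"
    using arg_cong[OF swap, of "order 0"] nz by (simp add: order_mult order_0_X_power)
  with length_nonzero_eigenvalues_le[OF carr] len
  have "order 0 (char_poly (B * A)) = 0" by simp
  then have root0: "poly (char_poly (B * A)) 0 \<noteq> 0" using nz by (simp add: order_root)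
  obtain v0 \<mu> where v0: "v0 \<noteq> 0" and ray: "\<And>x. \<mu> * (x \<bullet> x) \<le> (\<Sum>i<n. (?a i \<bullet> x)\<^sup>2)"
    and eig: "\<And>x. (\<Sum>i<n. (?a i \<bullet> v0) * (?a i \<bullet> x)) = \<mu> * (v0 \<bullet> x)"
    using rayleigh_quotient_min[where I = "{..<n}" and a = ?a] by blast
  have "eigenvector (B * A) (Matrix.vec ?d (\<lambda>k. v0 $ e k)) \<mu>"
    unfolding eigenvector_def
  proof (intro conjI)
    let ?w = "Matrix.vec ?d (\<lambda>k. v0 $ e k)"
    show "?w \<in> carrier_vec (dim_row (B * A))" using B by simp
    from v0 obtain c where "v0 $ c \<noteq> 0" by (auto simp: Finite_Cartesian_Product.vec_eq_iff)
    moreover obtain k where "k < ?d" "e k = c"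
      using e unfolding bij_betw_def by (metis UNIV_I imageE lessThan_iff)
    ultimately show "?w \<noteq> 0\<^sub>v (dim_row (B * A))"
      using B by (auto simp: Matrix.vec_eq_iff)
    have "(B * A) *\<^sub>v ?w = B *\<^sub>v (A *\<^sub>v ?w)" using A B by (simp add: assoc_mult_mat_vec)
    also have "\<dots> = \<mu> \<cdot>\<^sub>v ?w"
    proof (rule eq_vecI)
      fix k assume k: "k < dim_vec (\<mu> \<cdot>\<^sub>v ?w)"
      have "(B *\<^sub>v (A *\<^sub>v ?w)) $v k = (\<Sum>i<n. (?a i $ e k) * (?a i \<bullet> v0))"
        using k by (simp add: A_def B_def scalar_prod_def atLeast0LessThan inner_vec_def
            sum_e[of "\<lambda>c. ?a _ $ c * v0 $ c"])
      also have "\<dots> = (\<Sum>i<n. (?a i \<bullet> v0) * (?a i \<bullet> axis (e k) 1))"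
        by (simp add: inner_axis mult.commute)
      also have "\<dots> = \<mu> * (v0 \<bullet> axis (e k) 1)" by (rule eig)
      also have "\<dots> = \<mu> * v0 $ e k" by (simp add: inner_axis)
      finally show "(B *\<^sub>v (A *\<^sub>v ?w)) $v k = (\<mu> \<cdot>\<^sub>v ?w) $v k" using k by simp
    qed (use B in simp)
    finally show "(B * A) *\<^sub>v ?w = \<mu> \<cdot>\<^sub>v ?w" .
  qed
  then have root: "poly (char_poly (B * A)) \<mu> = 0"
    using eigenvalue_root_char_poly[OF carr'] by (auto simp: eigenvalue_def)
  with root0 have "\<mu> \<noteq> 0" by auto
  moreover have "poly (char_poly (centered_gram n z)) \<mu> = 0"
    using arg_cong[OF swap, of "\<lambda>p. poly p \<mu>"] root \<open>\<mu> \<noteq> 0\<close> by (simp add: poly_power)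
  ultimately have "\<mu> \<in> set (nonzero_eigenvalues (centered_gram n z))"
    using set_nonzero_eigenvalues[OF carr] by auto
  then obtain i where i: "i < ?d" "nonzero_eigenvalues (centered_gram n z) ! i = \<mu>"
    using len by (auto simp: in_set_conv_nth)
  then have le: "lam n z ?d \<le> \<mu>"
    using lam_antimono[OF len, of "Suc i" ?d] by (simp add: lam_def)
  then show "lam n z ?d * (v \<bullet> v) \<le> (\<Sum>i<n. (?a i \<bullet> v)\<^sup>2)"
    using ray[of v] mult_right_mono[OF le, of "v \<bullet> v"] by simp
  have "lam n z ?d \<in> set (nonzero_eigenvalues (centered_gram n z))"
    using len by (simp add: lam_def Suc_le_eq)
  then have l: "lam n z ?d \<noteq> 0" "poly (char_poly (centered_gram n z)) (lam n z ?d) = 0"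
    using set_nonzero_eigenvalues[OF carr] by auto
  then obtain w where w: "eigenvector (centered_gram n z) w (lam n z ?d)"
    using eigenvalue_root_char_poly[OF carr] by (auto simp: eigenvalue_def)
  then have wc: "w \<in> carrier_vec n" "w \<noteq> 0\<^sub>v n" "centered_gram n z *\<^sub>v w = lam n z ?d \<cdot>\<^sub>v w"
    using carr by (auto simp: eigenvector_def)
  have dimw: "dim_vec w = n" using wc by simp
  have "lam n z ?d * (\<Sum>i<n. w $v i * w $v i) = (\<Sum>i<n. w $v i * (centered_gram n z *\<^sub>v w) $v i)"
    unfolding wc(3) sum_distrib_left by (intro sum.cong refl) (use dimw in simp)
  also have "\<dots> = (\<Sum>i<n. w $v i * (\<Sum>j<n. (?a i \<bullet> ?a j) * w $v j))"
    using dimw by (intro sum.cong refl) (simp add: centered_gram_eq[OF n] scalar_prod_def atLeast0LessThan)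
  also have "\<dots> = (\<Sum>i<n. w $v i *\<^sub>R ?a i) \<bullet> (\<Sum>j<n. w $v j *\<^sub>R ?a j)"
    by (simp add: inner_sum_left inner_sum_right sum_distrib_left mult_ac inner_commute)
  also have "\<dots> \<ge> 0" by simp
  finally have "0 \<le> lam n z ?d * (\<Sum>i<n. w $v i * w $v i)" .
  moreover have "0 < (\<Sum>i<n. w $v i * w $v i)"
  proof -
    obtain i where "i < n" "w $v i \<noteq> 0" using wc(2) dimw by (auto simp: Matrix.vec_eq_iff)
    then show ?thesis by (intro sum_pos2[of _ i]) (auto simp: zero_less_mult_iff)
  qed
  ultimately show "0 < lam n z ?d" using l(1) by (simp add: zero_le_mult_iff)
qed

text \<open>For the last bunch, the second condition reads \<open>b \<le> \<lambda>\<^sub>d\<^sup>2 / \<lambda>\<close> with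
  some \<open>\<lambda> \<ge> \<lambda>\<^sub>d\<close>.\<close>

lemma last_bunch_gap_le_least_eigenvalue:
  fixes z :: "nat \<Rightarrow> real ^ 'd" and i :: "nat \<Rightarrow> nat"
  assumes n: "n > 0" and len: "length (nonzero_eigenvalues (centered_gram n z)) = CARD('d)"
    and i: "1 \<le> i k" "i k < i (k + 1)" "i (k + 1) = CARD('d) + 1"
    and b: "(lam n z (i (k + 1) - 1) - lam n z (i (k + 1)))\<^sup>2 / lam n z (i k) \<ge> b"
  shows "b \<le> lam n z CARD('d)"
proof -
  let ?l = "lam n z CARD('d)"
  have pos: "0 < ?l" by (rule least_eigenvalue_rayleigh[OF n len])
  have "b \<le> ?l\<^sup>2 / lam n z (i k)" using b i by (simp add: lam_def)
  also have "\<dots> \<le> ?l\<^sup>2 / ?l"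
    using pos i lam_antimono[OF len, of "i k" "CARD('d)"]
    by (intro divide_left_mono) (auto intro!: mult_pos_pos)
  finally show ?thesis using pos by (simp add: power2_eq_square)
qed

section \<open>Concentration for conditionally independent binary variables\<close>

lemma bernoulli_mgf_le:
  fixes p l :: real
  assumes "0 \<le> p" "p \<le> 1"
  shows "p * exp (l * (1 - p)) + (1 - p) * exp (l * (0 - p)) \<le> exp (l\<^sup>2 / 8)"
proof -
  have *: "p * exp (h * (1 - p)) + (1 - p) * exp (- h * p) \<le> exp (h\<^sup>2 / 8)"
    if p: "0 \<le> p" "p \<le> 1" and h: "h \<ge> 0" for p h :: real
  proof -
    have pos: "1 + p * (exp h - 1) > 0" using p h by (intro add_pos_nonneg mult_nonneg_nonneg) auto
    have "p * exp (h * (1 - p)) + (1 - p) * exp (- h * p) = exp (- h * p) * (1 + p * (exp h - 1))"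
      by (simp add: right_diff_distrib exp_diff exp_minus field_simps)
    also have "\<dots> = exp (- h * p + ln (1 + p * (exp h - 1)))"
      unfolding exp_add using pos by simp
    also have "\<dots> \<le> exp (h\<^sup>2 / 8)"
      using Hoeffdings_lemma_aux[OF h p(1)] by simp
    finally show ?thesis .
  qed
  show ?thesis
  proof (cases "l \<ge> 0")
    case True
    then show ?thesis using *[of p l] assms by simp
  next
    case False
    then show ?thesis using *[of "1 - p" "- l"] assms by (simp add: algebra_simps)
  qed
qed

lemma cond_prob_alg_binary:
  fixes X :: "'w \<Rightarrow> real"
  assumes "prob_space M" "subalgebra M F" and X: "X \<in> borel_measurable M"
    and val: "\<And>\<omega>. \<omega> \<in> space M \<Longrightarrow> X \<omega> \<in> {0, 1}"
    and p: "AE \<omega> in M. cond_prob_alg M F {\<omega>' \<in> space M. X \<omega>' = 1} \<omega> = p \<omega>"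
    and c: "c \<in> {0, 1}"
  shows "AE \<omega> in M. cond_prob_alg M F {\<omega>' \<in> space M. X \<omega>' \<in> {c}} \<omega> = (if c = 1 then p \<omega> else 1 - p \<omega>)"
proof (cases "c = 1")
  case True
  then show ?thesis using p by simp
next
  case False
  with c have c: "c = 0" by simp
  interpret prob_space M by fact
  interpret finite_measure_subalgebra M F
    using \<open>subalgebra M F\<close> by unfold_locales
  note [measurable] = X
  let ?A = "\<lambda>c. {\<omega>' \<in> space M. X \<omega>' = c}"
  have int: "integrable M (indicat_real (?A c))" for c
    by (simp add: integrable_indicator_iff emeasure_eq_measure)
  have "AE \<omega> in M. real_cond_exp M F (indicat_real (?A 0)) \<omega>
      = real_cond_exp M F (\<lambda>\<omega>. 1 - indicat_real (?A 1) \<omega>) \<omega>"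
  proof (rule real_cond_exp_cong)
    show "AE \<omega> in M. indicat_real (?A 0) \<omega> = 1 - indicat_real (?A 1) \<omega>"
      by (rule AE_I2) (use val in \<open>auto simp: indicator_def\<close>)
  qed (auto)
  moreover have "AE \<omega> in M. real_cond_exp M F (\<lambda>\<omega>. 1 - indicat_real (?A 1) \<omega>) \<omega>
      = real_cond_exp M F (\<lambda>_. 1) \<omega> - real_cond_exp M F (indicat_real (?A 1)) \<omega>"
    by (rule real_cond_exp_diff) (use int in auto)
  moreover have "AE \<omega> in M. real_cond_exp M F (\<lambda>_. 1 :: real) \<omega> = 1"
    by (rule real_cond_exp_F_meas) auto
  ultimately show ?thesis using p by eventually_elim (simp add: c cond_prob_alg_def)
qed

text \<open>The variables take finitely many values, so the exponential is a sum over configurations \<open>\<eta>\<close>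
  of an \<open>F\<close>-measurable factor times the indicator of \<open>X = \<eta>\<close>.  Conditioning on \<open>F\<close> replaces
  each indicator by a product of Bernoulli weights, and the sum over configurations then factors
  into moment generating functions of centered Bernoulli variables.  The success probabilities
  \<open>p\<close> are random, but the resulting bound does not depend on them.\<close>

lemma cond_indep_binary_mgf_le:
  fixes X p :: "'i \<Rightarrow> 'w \<Rightarrow> real" and w :: "'i \<Rightarrow> real"
  assumes M: "prob_space M" and F: "subalgebra M F" and I: "finite I"
    and indep: "cond_indep_vars M F (\<lambda>_. borel) X I"
    and val: "\<And>i \<omega>. i \<in> I \<Longrightarrow> \<omega> \<in> space M \<Longrightarrow> X i \<omega> \<in> {0, 1}"
    and cp: "\<And>i. i \<in> I \<Longrightarrow>
      AE \<omega> in M. cond_prob_alg M F {\<omega>' \<in> space M. X i \<omega>' = 1} \<omega> = p i \<omega>"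
    and p: "\<And>i. i \<in> I \<Longrightarrow> p i \<in> borel_measurable F"
    and p01: "\<And>i \<omega>. i \<in> I \<Longrightarrow> 0 \<le> p i \<omega> \<and> p i \<omega> \<le> 1"
  shows "integrable M (\<lambda>\<omega>. exp (\<Sum>i\<in>I. w i * (X i \<omega> - p i \<omega>)))"
    and "(\<integral>\<omega>. exp (\<Sum>i\<in>I. w i * (X i \<omega> - p i \<omega>)) \<partial>M) \<le> exp ((\<Sum>i\<in>I. (w i)\<^sup>2) / 8)"
proof -
  interpret prob_space M by fact
  interpret finite_measure_subalgebra M F
    using F by unfold_locales
  have X [measurable]: "X i \<in> borel_measurable M" if "i \<in> I" for i
    using indep that by (simp add: cond_indep_vars_def)
  have pM [measurable]: "p i \<in> borel_measurable M" if "i \<in> I" for i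
    using measurable_from_subalg[OF F p[OF that]] .
  define \<Omega> where "\<Omega> = PiE I (\<lambda>_. {0, 1 :: real})"
  have fin: "finite \<Omega>" unfolding \<Omega>_def using I by (intro finite_PiE) auto
  define A where "A \<eta> = {\<omega> \<in> space M. \<forall>i\<in>I. X i \<omega> \<in> {\<eta> i}}" for \<eta>
  define g where "g \<eta> \<omega> = exp (\<Sum>i\<in>I. w i * (\<eta> i - p i \<omega>))" for \<eta> \<omega>
  define \<rho> where "\<rho> c q = (if c = 1 then q else 1 - q)" for c q :: real
  have A [measurable]: "A \<eta> \<in> sets M" for \<eta>
    unfolding A_def using I by measurable
  have gF [measurable]: "g \<eta> \<in> borel_measurable F" for \<eta>
    unfolding g_def using p by measurable
  have gM [measurable]: "g \<eta> \<in> borel_measurable M" for \<eta>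
    using measurable_from_subalg[OF F gF] .
  have bound: "exp (\<Sum>i\<in>I. w i * (c i - p i \<omega>)) \<le> exp (\<Sum>i\<in>I. \<bar>w i\<bar>)"
    if "\<And>i. i \<in> I \<Longrightarrow> c i \<in> {0, 1}" for c \<omega>
  proof -
    have "w i * (c i - p i \<omega>) \<le> \<bar>w i\<bar>" if "i \<in> I" for i
    proof -
      have "\<bar>c i - p i \<omega>\<bar> \<le> 1" using p01[OF \<open>i \<in> I\<close>, of \<omega>] \<open>\<And>i. i \<in> I \<Longrightarrow> c i \<in> {0, 1}\<close>[OF that] by auto
      then have "\<bar>w i * (c i - p i \<omega>)\<bar> \<le> \<bar>w i\<bar> * 1"
        unfolding abs_mult by (intro mult_left_mono) auto
      then show ?thesis by simp
    qed
    then show ?thesis by (simp add: sum_mono)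
  qed
  show int: "integrable M (\<lambda>\<omega>. exp (\<Sum>i\<in>I. w i * (X i \<omega> - p i \<omega>)))"
  proof (rule integrable_const_bound)
    show "AE \<omega> in M. norm (exp (\<Sum>i\<in>I. w i * (X i \<omega> - p i \<omega>))) \<le> exp (\<Sum>i\<in>I. \<bar>w i\<bar>)"
      using val bound[of "\<lambda>i. X i _"] by (intro AE_I2) simp
  qed measurable
  have split: "exp (\<Sum>i\<in>I. w i * (X i \<omega> - p i \<omega>)) = (\<Sum>\<eta>\<in>\<Omega>. g \<eta> \<omega> * indicat_real (A \<eta>) \<omega>)"
    if \<omega>: "\<omega> \<in> space M" for \<omega>
  proof -
    let ?\<eta> = "restrict (\<lambda>i. X i \<omega>) I"
    have mem: "?\<eta> \<in> \<Omega>" using val[OF _ \<omega>] by (auto simp: \<Omega>_def)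
    have "indicat_real (A \<eta>) \<omega> = (if \<eta> = ?\<eta> then 1 else 0)" if "\<eta> \<in> \<Omega>" for \<eta>
    proof -
      have "\<omega> \<in> A \<eta> \<longleftrightarrow> (\<forall>i\<in>I. \<eta> i = X i \<omega>)" using \<omega> by (auto simp: A_def)
      also have "\<dots> \<longleftrightarrow> \<eta> = ?\<eta>"
        using that by (auto simp: \<Omega>_def PiE_def extensional_def fun_eq_iff)
      finally show ?thesis by (simp add: indicator_def)
    qed
    then have "(\<Sum>\<eta>\<in>\<Omega>. g \<eta> \<omega> * indicat_real (A \<eta>) \<omega>) = (\<Sum>\<eta>\<in>\<Omega>. if \<eta> = ?\<eta> then g \<eta> \<omega> else 0)"
      by (intro sum.cong refl) auto
    also have "\<dots> = g ?\<eta> \<omega>" using fin mem by simp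
    also have "\<dots> = exp (\<Sum>i\<in>I. w i * (X i \<omega> - p i \<omega>))" by (simp add: g_def)
    finally show ?thesis ..
  qed
  have \<Omega>01: "\<eta> i \<in> {0, 1}" if "\<eta> \<in> \<Omega>" "i \<in> I" for \<eta> i
    using that by (auto simp: \<Omega>_def)
  have g_le: "norm (g \<eta> \<omega>) \<le> exp (\<Sum>i\<in>I. \<bar>w i\<bar>)" if "\<eta> \<in> \<Omega>" for \<eta> \<omega>
    using bound[of \<eta> \<omega>] \<Omega>01[OF that] by (simp add: g_def)
  have int_gA: "integrable M (\<lambda>\<omega>. g \<eta> \<omega> * indicat_real (A \<eta>) \<omega>)" if "\<eta> \<in> \<Omega>" for \<eta>
  proof (rule integrable_const_bound)
    show "AE \<omega> in M. norm (g \<eta> \<omega> * indicat_real (A \<eta>) \<omega>) \<le> exp (\<Sum>i\<in>I. \<bar>w i\<bar>)"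
      using g_le[OF that] by (intro AE_I2) (auto simp: indicator_def)
  qed measurable
  define r where "r \<eta> \<omega> = (\<Prod>i\<in>I. exp (w i * (\<eta> i - p i \<omega>)) * \<rho> (\<eta> i) (p i \<omega>))" for \<eta> \<omega>
  have rM [measurable]: "r \<eta> \<in> borel_measurable M" for \<eta>
    unfolding r_def \<rho>_def by measurable
  have cond: "(\<integral>\<omega>. g \<eta> \<omega> * indicat_real (A \<eta>) \<omega> \<partial>M) = (\<integral>\<omega>. r \<eta> \<omega> \<partial>M)"
    and int_r: "integrable M (r \<eta>)" if \<eta>: "\<eta> \<in> \<Omega>" for \<eta>
  proof -
    have "AE \<omega> in M. cond_prob_alg M F (A \<eta>) \<omega>
        = (\<Prod>i\<in>I. cond_prob_alg M F {\<omega>' \<in> space M. X i \<omega>' \<in> {\<eta> i}} \<omega>)"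
      using indep I unfolding cond_indep_vars_def A_def by (elim conjE allE[of _ I] allE[of _ "\<lambda>i. {\<eta> i}"]) auto
    moreover have "AE \<omega> in M. \<forall>i\<in>I. cond_prob_alg M F {\<omega>' \<in> space M. X i \<omega>' \<in> {\<eta> i}} \<omega>
        = \<rho> (\<eta> i) (p i \<omega>)"
      unfolding \<rho>_def
      by (intro AE_finite_allI[OF I] cond_prob_alg_binary[OF M F] X val cp \<Omega>01[OF \<eta>])
    ultimately have eq: "AE \<omega> in M. g \<eta> \<omega> * real_cond_exp M F (indicat_real (A \<eta>)) \<omega> = r \<eta> \<omega>"
    proof eventually_elim
      case (elim \<omega>)
      then show ?case
        by (simp add: cond_prob_alg_def g_def r_def exp_sum[OF I] prod.distrib)
    qed
    note intg = real_cond_exp_intg[OF int_gA[OF \<eta>] gF]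
    have "(\<integral>\<omega>. g \<eta> \<omega> * indicat_real (A \<eta>) \<omega> \<partial>M)
        = (\<integral>\<omega>. g \<eta> \<omega> * real_cond_exp M F (indicat_real (A \<eta>)) \<omega> \<partial>M)"
      by (rule intg(2)[symmetric]) measurable
    also have "\<dots> = (\<integral>\<omega>. r \<eta> \<omega> \<partial>M)"
      by (rule integral_cong_AE[OF _ _ eq]) measurable
    finally show "(\<integral>\<omega>. g \<eta> \<omega> * indicat_real (A \<eta>) \<omega> \<partial>M) = (\<integral>\<omega>. r \<eta> \<omega> \<partial>M)" .
    show "integrable M (r \<eta>)"
      by (rule integrable_cong_AE_imp[OF intg(1) _ eq]) measurable
  qed
  have "(\<integral>\<omega>. exp (\<Sum>i\<in>I. w i * (X i \<omega> - p i \<omega>)) \<partial>M)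
      = (\<integral>\<omega>. (\<Sum>\<eta>\<in>\<Omega>. g \<eta> \<omega> * indicat_real (A \<eta>) \<omega>) \<partial>M)"
    by (rule Bochner_Integration.integral_cong[OF refl split])
  also have "\<dots> = (\<Sum>\<eta>\<in>\<Omega>. \<integral>\<omega>. g \<eta> \<omega> * indicat_real (A \<eta>) \<omega> \<partial>M)"
    by (rule Bochner_Integration.integral_sum) (rule int_gA)
  also have "\<dots> = (\<Sum>\<eta>\<in>\<Omega>. \<integral>\<omega>. r \<eta> \<omega> \<partial>M)"
    by (rule sum.cong[OF refl cond])
  also have "\<dots> = (\<integral>\<omega>. (\<Sum>\<eta>\<in>\<Omega>. r \<eta> \<omega>) \<partial>M)"
    by (rule Bochner_Integration.integral_sum[symmetric]) (rule int_r)
  also have "\<dots> \<le> (\<integral>\<omega>. exp ((\<Sum>i\<in>I. (w i)\<^sup>2) / 8) \<partial>M)"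
  proof (rule integral_mono)
    fix \<omega>
    have "(\<Sum>\<eta>\<in>\<Omega>. r \<eta> \<omega>) = (\<Prod>i\<in>I. \<Sum>c\<in>{0, 1}. exp (w i * (c - p i \<omega>)) * \<rho> c (p i \<omega>))"
      unfolding r_def \<Omega>_def by (rule prod_sum_PiE[symmetric]) (use I in auto)
    also have "\<dots> \<le> (\<Prod>i\<in>I. exp ((w i)\<^sup>2 / 8))"
    proof (rule prod_mono)
      fix i assume i: "i \<in> I"
      have "(\<Sum>c\<in>{0, 1}. exp (w i * (c - p i \<omega>)) * \<rho> c (p i \<omega>))
          = p i \<omega> * exp (w i * (1 - p i \<omega>)) + (1 - p i \<omega>) * exp (w i * (0 - p i \<omega>))"
        by (simp add: \<rho>_def mult.commute)
      moreover have "0 \<le> \<dots>" using p01[OF i, of \<omega>] by (intro add_nonneg_nonneg mult_nonneg_nonneg) auto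
      ultimately show "0 \<le> (\<Sum>c\<in>{0, 1}. exp (w i * (c - p i \<omega>)) * \<rho> c (p i \<omega>)) \<and>
          (\<Sum>c\<in>{0, 1}. exp (w i * (c - p i \<omega>)) * \<rho> c (p i \<omega>)) \<le> exp ((w i)\<^sup>2 / 8)"
        using bernoulli_mgf_le[of "p i \<omega>" "w i"] p01[OF i, of \<omega>] by simp
    qed
    also have "\<dots> = exp ((\<Sum>i\<in>I. (w i)\<^sup>2) / 8)"
      using I by (simp add: exp_sum[symmetric] sum_divide_distrib)
    finally show "(\<Sum>\<eta>\<in>\<Omega>. r \<eta> \<omega>) \<le> exp ((\<Sum>i\<in>I. (w i)\<^sup>2) / 8)" .
  qed (use int_r in auto)
  also have "\<dots> = exp ((\<Sum>i\<in>I. (w i)\<^sup>2) / 8)" by (simp add: prob_space)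
  finally show "(\<integral>\<omega>. exp (\<Sum>i\<in>I. w i * (X i \<omega> - p i \<omega>)) \<partial>M) \<le> exp ((\<Sum>i\<in>I. (w i)\<^sup>2) / 8)" .
qed

text \<open>The Chernoff bound, applied to \<open>w\<close> and to \<open>-w\<close>.\<close>

lemma cond_indep_binary_tail:
  fixes X p :: "'i \<Rightarrow> 'w \<Rightarrow> real" and w :: "'i \<Rightarrow> real"
  assumes M: "prob_space M" and F: "subalgebra M F" and I: "finite I"
    and indep: "cond_indep_vars M F (\<lambda>_. borel) X I"
    and val: "\<And>i \<omega>. i \<in> I \<Longrightarrow> \<omega> \<in> space M \<Longrightarrow> X i \<omega> \<in> {0, 1}"
    and cp: "\<And>i. i \<in> I \<Longrightarrow>
      AE \<omega> in M. cond_prob_alg M F {\<omega>' \<in> space M. X i \<omega>' = 1} \<omega> = p i \<omega>"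
    and p: "\<And>i. i \<in> I \<Longrightarrow> p i \<in> borel_measurable F"
    and p01: "\<And>i \<omega>. i \<in> I \<Longrightarrow> 0 \<le> p i \<omega> \<and> p i \<omega> \<le> 1"
    and V: "(\<Sum>i\<in>I. (w i)\<^sup>2) \<le> V" "0 < V" and t: "0 < t"
  shows "measure M {\<omega> \<in> space M. t \<le> \<bar>\<Sum>i\<in>I. w i * (X i \<omega> - p i \<omega>)\<bar>} \<le> 2 * exp (- 2 * t\<^sup>2 / V)"
proof -
  interpret prob_space M by fact
  have X [measurable]: "X i \<in> borel_measurable M" if "i \<in> I" for i
    using indep that by (simp add: cond_indep_vars_def)
  have pM [measurable]: "p i \<in> borel_measurable M" if "i \<in> I" for i
    using measurable_from_subalg[OF F p[OF that]] .
  define D where "D w \<omega> = (\<Sum>i\<in>I. w i * (X i \<omega> - p i \<omega>))" for w \<omega>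
  have D [measurable]: "D w \<in> borel_measurable M" for w unfolding D_def by measurable
  have one_sided: "measure M {\<omega> \<in> space M. t \<le> D w \<omega>} \<le> exp (- 2 * t\<^sup>2 / V)"
    if w: "(\<Sum>i\<in>I. (w i)\<^sup>2) \<le> V" for w :: "'i \<Rightarrow> real"
  proof -
    \<comment> \<open>The minimizer of \<open>s\<^sup>2 V / 8 - s t\<close>.\<close>
    define s where "s = 4 * t / V"
    have s: "0 < s" using V(2) t by (simp add: s_def)
    have sD: "s * D w \<omega> = (\<Sum>i\<in>I. (s * w i) * (X i \<omega> - p i \<omega>))" for \<omega>
      by (simp add: D_def sum_distrib_left mult.assoc)
    note mgf = cond_indep_binary_mgf_le[OF M F I indep val cp p p01, of "\<lambda>i. s * w i", folded sD]
    have "{\<omega> \<in> space M. t \<le> D w \<omega>} = {\<omega> \<in> space M. exp (s * t) \<le> exp (s * D w \<omega>)}"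
      using s by auto
    also have "measure M \<dots> \<le> (\<integral>\<omega>. exp (s * D w \<omega>) \<partial>M) / exp (s * t)"
      by (rule integral_Markov_inequality_measure[OF mgf(1), of "{}"]) auto
    also have "\<dots> \<le> exp ((\<Sum>i\<in>I. (s * w i)\<^sup>2) / 8) / exp (s * t)"
      by (intro divide_right_mono mgf(2)) auto
    also have "\<dots> = exp (s\<^sup>2 * (\<Sum>i\<in>I. (w i)\<^sup>2) / 8 - s * t)"
      by (simp add: exp_diff power_mult_distrib sum_distrib_left)
    also have "\<dots> \<le> exp (s\<^sup>2 * V / 8 - s * t)"
      using w by (simp add: mult_left_mono)
    also have "s\<^sup>2 * V / 8 - s * t = - 2 * t\<^sup>2 / V"
      using V(2) by (simp add: s_def power2_eq_square field_simps)
    finally show ?thesis .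
  qed
  have "measure M {\<omega> \<in> space M. t \<le> \<bar>D w \<omega>\<bar>}
      = measure M ({\<omega> \<in> space M. t \<le> D w \<omega>} \<union> {\<omega> \<in> space M. t \<le> D (\<lambda>i. - w i) \<omega>})"
    by (rule arg_cong[where f = "measure M"]) (auto simp: D_def sum_negf)
  also have "\<dots> \<le> measure M {\<omega> \<in> space M. t \<le> D w \<omega>}
      + measure M {\<omega> \<in> space M. t \<le> D (\<lambda>i. - w i) \<omega>}"
    by (intro measure_Un_le) auto
  also have "\<dots> \<le> exp (- 2 * t\<^sup>2 / V) + exp (- 2 * t\<^sup>2 / V)"
    using V(1) by (intro add_mono one_sided) simp_all
  finally show ?thesis by (simp add: D_def)
qed

section \<open>Chaining over dyadic nets\<close>

text \<open>Rounding towards zero to a multiple of \<open>2 R / 2\<^sup>k\<close>.  Rounding towards zero, and not to the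
  nearest point, keeps a vector inside every ball around the origin that contains it; and with
  this mesh the points of \<open>[-R, R]\<close> all go to \<open>0\<close> at level \<open>0\<close>, so that every chain starts at
  the same configuration.\<close>

definition trunc_grid :: "real \<Rightarrow> nat \<Rightarrow> real \<Rightarrow> real" where
  "trunc_grid R k x = 2 * R / 2 ^ k *
     (if 0 \<le> x then real_of_int \<lfloor>x / (2 * R / 2 ^ k)\<rfloor> else real_of_int \<lceil>x / (2 * R / 2 ^ k)\<rceil>)"

lemma trunc_grid_between:
  assumes "R > 0"
  shows "0 \<le> x \<Longrightarrow> 0 \<le> trunc_grid R k x \<and> trunc_grid R k x \<le> x \<and> x \<le> trunc_grid R k x + 2 * R / 2 ^ k"
    and "x < 0 \<Longrightarrow> trunc_grid R k x \<le> 0 \<and> x \<le> trunc_grid R k x \<and> trunc_grid R k x \<le> x + 2 * R / 2 ^ k"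
proof -
  define s where "s = 2 * R / 2 ^ k"
  have s: "0 < s" using assms by (simp add: s_def)
  have f: "s * real_of_int \<lfloor>x / s\<rfloor> \<le> x" "x \<le> s * real_of_int \<lfloor>x / s\<rfloor> + s"
    using mult_left_mono[of "real_of_int \<lfloor>x / s\<rfloor>" "x / s" s] s
      mult_left_mono[of "x / s" "real_of_int \<lfloor>x / s\<rfloor> + 1" s]
    by (auto simp: algebra_simps) linarith
  have c: "x \<le> s * real_of_int \<lceil>x / s\<rceil>" "s * real_of_int \<lceil>x / s\<rceil> \<le> x + s"
    using mult_left_mono[of "x / s" "real_of_int \<lceil>x / s\<rceil>" s] s
      mult_left_mono[of "real_of_int \<lceil>x / s\<rceil>" "x / s + 1" s]
    by (auto simp: algebra_simps) linarith
  show "0 \<le> x \<Longrightarrow> 0 \<le> trunc_grid R k x \<and> trunc_grid R k x \<le> x \<and> x \<le> trunc_grid R k x + 2 * R / 2 ^ k"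
    using f s by (simp add: trunc_grid_def s_def[symmetric])
  assume "x < 0"
  then have "\<lceil>x / s\<rceil> \<le> 0" using s by (simp add: ceiling_le_zero divide_le_0_iff)
  with \<open>x < 0\<close> c s show "trunc_grid R k x \<le> 0 \<and> x \<le> trunc_grid R k x \<and> trunc_grid R k x \<le> x + 2 * R / 2 ^ k"
    by (simp add: trunc_grid_def s_def[symmetric] mult_nonneg_nonpos)
qed

lemma trunc_grid_le: "R > 0 \<Longrightarrow> \<bar>trunc_grid R k x\<bar> \<le> \<bar>x\<bar>"
  using trunc_grid_between[of R x k] by (cases "0 \<le> x") auto

lemma trunc_grid_error: "R > 0 \<Longrightarrow> \<bar>x - trunc_grid R k x\<bar> \<le> 2 * R / 2 ^ k"
  using trunc_grid_between[of R x k] by (cases "0 \<le> x") auto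

lemma trunc_grid_step: 
  assumes "R > 0"
  shows "\<bar>trunc_grid R (Suc k) x - trunc_grid R k x\<bar> \<le> 2 * R / 2 ^ k"
proof -
  have "2 * R / 2 ^ Suc k \<le> 2 * R / 2 ^ k" using assms by (simp add: field_simps)
  then show ?thesis
    using trunc_grid_between[OF assms, of x k] trunc_grid_between[OF assms, of x "Suc k"]
    by (cases "0 \<le> x") auto
qed

lemma trunc_grid_0: "R > 0 \<Longrightarrow> \<bar>x\<bar> \<le> R \<Longrightarrow> trunc_grid R 0 x = 0"
  by (auto simp: trunc_grid_def floor_eq_iff ceiling_eq_iff field_simps)

definition grid :: "real \<Rightarrow> nat \<Rightarrow> real set" where
  "grid R k = (\<lambda>l. 2 * R / 2 ^ k * real_of_int l) ` {- (2 ^ k)..2 ^ k}"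

lemma finite_grid: "finite (grid R k)" by (simp add: grid_def)

lemma card_grid_le: "card (grid R k) \<le> 2 ^ (k + 2)"
proof -
  have "card (grid R k) \<le> card {- (2 ^ k)..2 ^ k :: int}"
    unfolding grid_def by (rule card_image_le) simp
  also have "\<dots> = nat (2 * 2 ^ k + 1)" by simp
  also have "\<dots> \<le> nat (4 * 2 ^ k)"
  proof (rule nat_mono)
    have "(1 :: int) \<le> 2 ^ k" by (rule one_le_power) simp
    then show "2 * 2 ^ k + 1 \<le> (4 * 2 ^ k :: int)" by linarith
  qed
  also have "\<dots> = 2 ^ (k + 2)" by (simp add: nat_mult_distrib nat_power_eq)
  finally show ?thesis .
qed

lemma trunc_grid_mem:
  assumes R: "R > 0" and x: "\<bar>x\<bar> \<le> R"
  shows "trunc_grid R k x \<in> grid R k"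
proof -
  define s where "s = 2 * R / 2 ^ k"
  have s: "0 < s" using R by (simp add: s_def)
  define l where "l = (if 0 \<le> x then \<lfloor>x / s\<rfloor> else \<lceil>x / s\<rceil>)"
  have eq: "trunc_grid R k x = s * real_of_int l" by (simp add: trunc_grid_def s_def l_def)
  have "\<bar>s * real_of_int l\<bar> \<le> R" using trunc_grid_le[OF R, of k x] x by (simp add: eq)
  also have "R \<le> s * 2 ^ k" using R by (simp add: s_def)
  finally have "s * \<bar>real_of_int l\<bar> \<le> s * 2 ^ k" using s by (simp add: abs_mult)
  then have "\<bar>real_of_int l\<bar> \<le> 2 ^ k" using s by simp
  then have "real_of_int \<bar>l\<bar> \<le> real_of_int (2 ^ k)" by simp
  then have "\<bar>l\<bar> \<le> 2 ^ k" by (simp only: of_int_le_iff)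
  then show ?thesis unfolding eq grid_def s_def by (auto simp: abs_le_iff)
qed

definition vgrid :: "real \<Rightarrow> nat \<Rightarrow> (real ^ 'd) set" where
  "vgrid R k = {v. \<forall>c. v $ c \<in> grid R k}"

lemma vgrid_finite_card:
  "finite (vgrid R k :: (real ^ 'd) set)" "card (vgrid R k :: (real ^ 'd) set) \<le> 2 ^ ((k + 2) * CARD('d))"
proof -
  let ?P = "PiE (UNIV :: 'd set) (\<lambda>_. grid R k)"
  have sub: "(vgrid R k :: (real ^ 'd) set) \<subseteq> vec_lambda ` ?P"
  proof
    fix v :: "real ^ 'd" assume "v \<in> vgrid R k"
    then have "(\<lambda>c. v $ c) \<in> ?P" by (auto simp: vgrid_def)
    then show "v \<in> vec_lambda ` ?P" by (metis image_eqI vec_lambda_eta)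
  qed
  have fin: "finite ?P" by (intro finite_PiE) (auto simp: finite_grid)
  show "finite (vgrid R k :: (real ^ 'd) set)" using sub fin by (meson finite_imageI finite_subset)
  have "card (vgrid R k :: (real ^ 'd) set) \<le> card ?P"
    using sub fin by (rule surj_card_le[rotated])
  also have "\<dots> = card (grid R k) ^ CARD('d)" by (simp add: card_PiE)
  also have "\<dots> \<le> (2 ^ (k + 2)) ^ CARD('d)" by (intro power_mono card_grid_le) simp
  finally show "card (vgrid R k :: (real ^ 'd) set) \<le> 2 ^ ((k + 2) * CARD('d))"
    by (simp only: power_mult)
qed

definition net :: "nat \<Rightarrow> real \<Rightarrow> nat \<Rightarrow> (nat \<Rightarrow> real ^ 'd) set" where
  "net n R k = PiE {..<n} (\<lambda>_. vgrid R k)"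

lemma net_finite_card:
  "finite (net n R k :: (nat \<Rightarrow> real ^ 'd) set)"
  "card (net n R k :: (nat \<Rightarrow> real ^ 'd) set) \<le> 2 ^ ((k + 2) * CARD('d) * n)"
proof -
  show "finite (net n R k :: (nat \<Rightarrow> real ^ 'd) set)"
    unfolding net_def by (intro finite_PiE) (auto simp: vgrid_finite_card)
  have "card (net n R k :: (nat \<Rightarrow> real ^ 'd) set) = card (vgrid R k :: (real ^ 'd) set) ^ n"
    by (simp add: net_def card_PiE)
  also have "\<dots> \<le> (2 ^ ((k + 2) * CARD('d))) ^ n" by (intro power_mono vgrid_finite_card) simp
  finally show "card (net n R k :: (nat \<Rightarrow> real ^ 'd) set) \<le> 2 ^ ((k + 2) * CARD('d) * n)"
    by (simp only: power_mult)
qed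

text \<open>The links between consecutive levels of a chain.  The number of links at level \<open>k\<close> is
  exponential in \<open>k n d\<close>, while the increments along them shrink like \<open>2\<^sup>-\<^sup>k\<close>.\<close>

definition net_edges :: "nat \<Rightarrow> real \<Rightarrow> nat \<Rightarrow> ((nat \<Rightarrow> real ^ 'd) \<times> (nat \<Rightarrow> real ^ 'd)) set" where
  "net_edges n R k = {(u, v) \<in> net n R k \<times> net n R (Suc k). \<forall>i<n. norm (u i) \<le> R \<and> norm (v i) \<le> R \<and>
     norm (v i - u i) \<le> sqrt (real CARD('d)) * (2 * R / 2 ^ k)}"

lemma net_edges_finite_card:
  "finite (net_edges n R k :: ((nat \<Rightarrow> real ^ 'd) \<times> (nat \<Rightarrow> real ^ 'd)) set)"
  "card (net_edges n R k :: ((nat \<Rightarrow> real ^ 'd) \<times> (nat \<Rightarrow> real ^ 'd)) set)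
    \<le> 2 ^ ((2 * k + 5) * CARD('d) * n)"
proof -
  let ?E = "net_edges n R k :: ((nat \<Rightarrow> real ^ 'd) \<times> (nat \<Rightarrow> real ^ 'd)) set"
  let ?N = "\<lambda>k. net n R k :: (nat \<Rightarrow> real ^ 'd) set"
  have sub: "?E \<subseteq> ?N k \<times> ?N (Suc k)" by (auto simp: net_edges_def)
  have fin: "finite (?N k \<times> ?N (Suc k))" by (intro finite_cartesian_product net_finite_card)
  show "finite ?E" using sub fin by (rule finite_subset)
  have "card ?E \<le> card (?N k) * card (?N (Suc k))"
    using card_mono[OF fin sub] by (simp add: card_cartesian_product)
  also have "\<dots> \<le> 2 ^ ((k + 2) * CARD('d) * n) * 2 ^ ((Suc k + 2) * CARD('d) * n)"
    by (intro mult_mono net_finite_card) auto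
  also have "\<dots> = 2 ^ ((2 * k + 5) * CARD('d) * n)"
    by (simp add: power_add[symmetric] algebra_simps)
  finally show "card ?E \<le> 2 ^ ((2 * k + 5) * CARD('d) * n)" .
qed

definition trunc_config :: "nat \<Rightarrow> real \<Rightarrow> nat \<Rightarrow> (nat \<Rightarrow> real ^ 'd) \<Rightarrow> nat \<Rightarrow> real ^ 'd" where
  "trunc_config n R k z = (\<lambda>i\<in>{..<n}. \<chi> c. trunc_grid R k (z i $ c))"

lemma norm_le_sqrt_card:
  fixes x :: "real ^ 'd"
  assumes "\<And>c. \<bar>x $ c\<bar> \<le> B"
  shows "norm x \<le> sqrt (real CARD('d)) * B"
proof -
  have B: "0 \<le> B" using assms[of undefined] by linarith
  have "norm x \<le> norm (\<chi> c. B :: real ^ 'd)"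
    using assms B by (intro norm_le_componentwise_cart) simp
  also have "\<dots> = sqrt (real CARD('d)) * B"
    using B by (simp add: norm_vec_def L2_set_def real_sqrt_mult)
  finally show ?thesis .
qed

context
  fixes n :: nat and R :: real and z :: "nat \<Rightarrow> real ^ 'd"
  assumes R: "R > 0" and z: "\<And>i. i < n \<Longrightarrow> norm (z i) \<le> R"
begin

lemma coord_le: "i < n \<Longrightarrow> \<bar>z i $ c\<bar> \<le> R"
  using component_le_norm_cart[of "z i" c] z[of i] by linarith

lemma norm_trunc_config_le: "i < n \<Longrightarrow> norm (trunc_config n R k z i) \<le> R"
proof -
  assume i: "i < n"
  have "norm (trunc_config n R k z i) \<le> norm (z i)"
    using i trunc_grid_le[OF R] by (intro norm_le_componentwise_cart) (simp add: trunc_config_def)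
  with z[OF i] show ?thesis by simp
qed

lemma trunc_config_error:
  "i < n \<Longrightarrow> norm (z i - trunc_config n R k z i) \<le> sqrt (real CARD('d)) * (2 * R / 2 ^ k)"
  by (rule norm_le_sqrt_card) (simp add: trunc_config_def trunc_grid_error[OF R])

lemma trunc_config_mem: "trunc_config n R k z \<in> net n R k"
  by (auto simp: net_def trunc_config_def vgrid_def intro!: trunc_grid_mem[OF R] coord_le)

lemma trunc_config_0: "i < n \<Longrightarrow> trunc_config n R 0 z i = 0"
  by (simp add: trunc_config_def trunc_grid_0[OF R coord_le] Finite_Cartesian_Product.vec_eq_iff)

lemma trunc_config_edge: "(trunc_config n R k z, trunc_config n R (Suc k) z) \<in> net_edges n R k"
proof -
  have "norm (trunc_config n R (Suc k) z i - trunc_config n R k z i)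
      \<le> sqrt (real CARD('d)) * (2 * R / 2 ^ k)" if "i < n" for i
    by (rule norm_le_sqrt_card) (use that trunc_grid_step[OF R] in \<open>simp add: trunc_config_def\<close>)
  then show ?thesis by (simp add: net_edges_def trunc_config_mem norm_trunc_config_le)
qed

end

definition node_pairs :: "nat \<Rightarrow> (nat \<times> nat) set" where
  "node_pairs n = {(i, j). i < j \<and> j < n}"

lemma finite_node_pairs: "finite (node_pairs n)"
  by (rule finite_subset[of _ "{..<n} \<times> {..<n}"]) (auto simp: node_pairs_def)

lemma card_node_pairs_le: "card (node_pairs n) \<le> n\<^sup>2"
proof -
  have "card (node_pairs n) \<le> card ({..<n} \<times> {..<n})"
    by (rule card_mono) (auto simp: node_pairs_def)
  then show ?thesis by (simp add: card_cartesian_product power2_eq_square)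
qed

text \<open>The change of the pair interaction \<open>h\<close> at the pair \<open>q\<close> along a link from \<open>u\<close> to \<open>v\<close>.\<close>

definition pair_diff ::
  "(real \<Rightarrow> real) \<Rightarrow> (nat \<Rightarrow> real ^ 'd) \<Rightarrow> (nat \<Rightarrow> real ^ 'd) \<Rightarrow> nat \<times> nat \<Rightarrow> real" where
  "pair_diff h u v q = h (norm (v (fst q) - v (snd q))) - h (norm (u (fst q) - u (snd q)))"

lemma pair_diff_le:
  fixes u v :: "nat \<Rightarrow> real ^ 'd"
  assumes h: "\<And>x y. 0 \<le> x \<Longrightarrow> x \<le> 2 * R \<Longrightarrow> 0 \<le> y \<Longrightarrow> y \<le> 2 * R \<Longrightarrow> \<bar>h x - h y\<bar> \<le> L * \<bar>x\<^sup>2 - y\<^sup>2\<bar>"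
    and L: "0 \<le> L"
    and uv: "\<And>i. i < n \<Longrightarrow> norm (u i) \<le> R \<and> norm (v i) \<le> R \<and> norm (v i - u i) \<le> \<delta>"
    and q: "q \<in> node_pairs n"
  shows "\<bar>pair_diff h u v q\<bar> \<le> 8 * L * R * \<delta>"
proof -
  obtain i j where q': "q = (i, j)" "i < n" "j < n" using q by (auto simp: node_pairs_def)
  define x where "x = norm (v i - v j)"
  define y where "y = norm (u i - u j)"
  have x: "0 \<le> x" "x \<le> 2 * R"
    using norm_triangle_ineq4[of "v i" "v j"] uv[of i] uv[of j] q' by (auto simp: x_def)
  have y: "0 \<le> y" "y \<le> 2 * R"
    using norm_triangle_ineq4[of "u i" "u j"] uv[of i] uv[of j] q' by (auto simp: y_def)
  have "\<bar>x - y\<bar> \<le> norm ((v i - v j) - (u i - u j))"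
    unfolding x_def y_def by (rule norm_triangle_ineq3)
  also have "(v i - v j) - (u i - u j) = (v i - u i) - (v j - u j)" by simp
  also have "norm \<dots> \<le> 2 * \<delta>"
    using norm_triangle_ineq4[of "v i - u i" "v j - u j"] uv[of i] uv[of j] q' by simp
  finally have xy: "\<bar>x - y\<bar> \<le> 2 * \<delta>" .
  have "\<bar>pair_diff h u v q\<bar> \<le> L * \<bar>x\<^sup>2 - y\<^sup>2\<bar>"
    using h[of x y] x y by (simp add: pair_diff_def q' x_def y_def)
  also have "\<bar>x\<^sup>2 - y\<^sup>2\<bar> = \<bar>x - y\<bar> * (x + y)"
    using x y by (simp add: power2_eq_square square_diff_square_factored abs_mult mult.commute)
  also have "L * (\<bar>x - y\<bar> * (x + y)) \<le> L * ((2 * \<delta>) * (4 * R))"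
    using xy x y L by (intro mult_left_mono mult_mono) auto
  finally show ?thesis by (simp add: mult_ac)
qed

text \<open>A bound for \<open>pair_diff\<close> along the links of level \<open>k\<close> in dimension \<open>d\<close>, when \<open>h\<close> is
  \<open>L\<close>-Lipschitz as a function of the squared distance.\<close>

definition step_size :: "real \<Rightarrow> real \<Rightarrow> real \<Rightarrow> nat \<Rightarrow> real" where
  "step_size L R d k = 16 * L * R\<^sup>2 * sqrt d / 2 ^ k"

text \<open>The deviation allowed on level \<open>k\<close>.  The factor \<open>sqrt (n d) (k + 3)\<close> makes the Gaussian tail
  beat the number of links of that level, and its growth in \<open>k\<close> is slow enough for the sum over all
  levels to remain of the order of the first term.\<close>

definition step_tail :: "real \<Rightarrow> real \<Rightarrow> real \<Rightarrow> nat \<Rightarrow> nat \<Rightarrow> real" where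
  "step_tail L R d n k = step_size L R d k * real n * sqrt (real n * d) * (real k + 3)"

lemma sum_weighted_halves: "(\<Sum>k<n. (real k + 3) / 2 ^ k) = 8 - (2 * real n + 8) / 2 ^ n"
proof (induction n)
  case (Suc n)
  have "(2 * real n + 8) / 2 ^ n = (4 * real n + 16) / 2 ^ Suc n"
    "(real n + 3) / 2 ^ n = (2 * real n + 6) / 2 ^ Suc n"
    by (simp_all add: field_simps)
  with Suc show ?case by (simp add: diff_divide_distrib add_divide_distrib)
qed simp

text \<open>The deterministic half of the chaining argument: telescope along the truncations of \<open>z\<close> at the
  levels \<open>0, \<dots>, n\<close>.  Level \<open>n\<close> has a mesh of order \<open>2\<^sup>-\<^sup>n\<close>, so there the remaining increment
  is small for every single pair and no concentration is needed.  A single net of mesh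
  \<open>n\<^sup>-\<^sup>1\<^sup>/\<^sup>2\<close> would cost an additional \<open>sqrt (ln n)\<close>.\<close>

lemma chaining_bound:
  fixes z :: "nat \<Rightarrow> real ^ 'd" and e :: "nat \<times> nat \<Rightarrow> real"
  assumes h: "\<And>x y. 0 \<le> x \<Longrightarrow> x \<le> 2 * R \<Longrightarrow> 0 \<le> y \<Longrightarrow> y \<le> 2 * R \<Longrightarrow> \<bar>h x - h y\<bar> \<le> L * \<bar>x\<^sup>2 - y\<^sup>2\<bar>"
    and L: "0 \<le> L" and R: "R > 0" and n: "n \<ge> 1"
    and z: "\<And>i. i < n \<Longrightarrow> norm (z i) \<le> R"
    and e: "\<And>q. q \<in> node_pairs n \<Longrightarrow> \<bar>e q\<bar> \<le> 1"
    and steps: "\<And>k (u :: nat \<Rightarrow> real ^ 'd) v. k < n \<Longrightarrow> (u, v) \<in> net_edges n R k \<Longrightarrow>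
      \<bar>\<Sum>q\<in>node_pairs n. pair_diff h u v q * e q\<bar> \<le> step_tail L R (real CARD('d)) n k"
  shows "\<bar>\<Sum>q\<in>node_pairs n. (h (norm (z (fst q) - z (snd q))) - h 0) * e q\<bar>
    \<le> 144 * L * R\<^sup>2 * real CARD('d) * (real n * sqrt (real n))"
proof -
  let ?d = "real CARD('d)"
  let ?T = "\<lambda>k. trunc_config n R k z"
  define S where "S u = (\<Sum>q\<in>node_pairs n. h (norm (u (fst q) - u (snd q))) * e q)" for u :: "nat \<Rightarrow> real ^ 'd"
  have S_diff: "(\<Sum>q\<in>node_pairs n. pair_diff h u v q * e q) = S v - S u" for u v
    by (simp add: pair_diff_def S_def left_diff_distrib sum_subtractf)
  have d1: "1 \<le> ?d" by (simp add: Suc_le_eq)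
  have sqd: "sqrt ?d \<le> ?d" using d1 by (simp add: real_le_lsqrt power2_eq_square)
  have edge: "(?T k, ?T (Suc k)) \<in> net_edges n R k" for k
    by (rule trunc_config_edge[OF R]) (rule z)
  have norm_T: "norm (?T k i) \<le> R" if "i < n" for k i
    by (rule norm_trunc_config_le[OF R _ that]) (rule z)
  have error_T: "norm (z i - ?T k i) \<le> sqrt ?d * (2 * R / 2 ^ k)" if "i < n" for k i
    by (rule trunc_config_error[OF R _ that]) (rule z)
  have T0: "?T 0 i = 0" if "i < n" for i
    by (rule trunc_config_0[OF R _ that]) (rule z)
  have S0: "S (?T 0) = (\<Sum>q\<in>node_pairs n. h 0 * e q)"
    unfolding S_def by (intro sum.cong refl) (auto simp: node_pairs_def T0)
  have "\<bar>S (?T m) - S (?T 0)\<bar> \<le> (\<Sum>k<m. step_tail L R ?d n k)" if "m \<le> n" for m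
    using that
  proof (induction m)
    case (Suc m)
    have "\<bar>S (?T (Suc m)) - S (?T m)\<bar> \<le> step_tail L R ?d n m"
      using steps[OF _ edge, of m] Suc.prems by (simp add: S_diff)
    with Suc show ?case by simp
  qed simp
  from this[of n] have chain: "\<bar>S (?T n) - S (?T 0)\<bar> \<le> (\<Sum>k<n. step_tail L R ?d n k)" by simp
  have "(\<Sum>k<n. step_tail L R ?d n k)
      = 16 * L * R\<^sup>2 * ?d * (real n * sqrt (real n)) * (\<Sum>k<n. (real k + 3) / 2 ^ k)"
    unfolding sum_distrib_left
    by (intro sum.cong refl) (simp add: step_tail_def step_size_def real_sqrt_mult)
  also have "\<dots> \<le> 16 * L * R\<^sup>2 * ?d * (real n * sqrt (real n)) * 8"
    using L by (intro mult_left_mono mult_nonneg_nonneg) (simp_all add: sum_weighted_halves)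
  finally have total: "(\<Sum>k<n. step_tail L R ?d n k) \<le> 128 * L * R\<^sup>2 * ?d * (real n * sqrt (real n))"
    by simp
  have "\<bar>S z - S (?T n)\<bar> = \<bar>\<Sum>q\<in>node_pairs n. pair_diff h (?T n) z q * e q\<bar>"
    by (simp add: S_diff)
  also have "\<dots> \<le> (\<Sum>q\<in>node_pairs n. step_size L R ?d n)"
  proof (rule order_trans[OF sum_abs], rule sum_mono)
    fix q assume q: "q \<in> node_pairs n"
    have "\<bar>pair_diff h (?T n) z q\<bar> \<le> 8 * L * R * (sqrt ?d * (2 * R / 2 ^ n))"
      by (rule pair_diff_le[OF h L _ q])
        (use z norm_T error_T in auto)
    also have "\<dots> = step_size L R ?d n" by (simp add: step_size_def power2_eq_square)
    finally have "\<bar>pair_diff h (?T n) z q\<bar> * \<bar>e q\<bar> \<le> step_size L R ?d n * 1"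
      using e[OF q] by (intro mult_mono) auto
    then show "\<bar>pair_diff h (?T n) z q * e q\<bar> \<le> step_size L R ?d n" by (simp add: abs_mult)
  qed
  also have "\<dots> = real (card (node_pairs n)) * step_size L R ?d n" by simp
  also have "\<dots> \<le> (real n)\<^sup>2 * step_size L R ?d n"
    using card_node_pairs_le[of n] L
    by (intro mult_right_mono) (simp_all add: step_size_def of_nat_power[symmetric] del: of_nat_power)
  also have "\<dots> = 16 * L * R\<^sup>2 * (sqrt ?d * (real n * (real n / 2 ^ n)))"
    by (simp add: step_size_def power2_eq_square)
  also have "\<dots> \<le> 16 * L * R\<^sup>2 * (?d * (real n * sqrt (real n)))"
  proof -
    have "real n \<le> 2 ^ n" by (rule less_imp_le[OF of_nat_less_two_power])
    then have "real n / 2 ^ n \<le> 1" by simp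
    also have "1 \<le> sqrt (real n)" using n by simp
    finally show ?thesis using L sqd d1 by (intro mult_left_mono mult_mono) auto
  qed
  finally have rest: "\<bar>S z - S (?T n)\<bar> \<le> 16 * L * R\<^sup>2 * ?d * (real n * sqrt (real n))"
    by (simp add: mult_ac)
  have "(\<Sum>q\<in>node_pairs n. (h (norm (z (fst q) - z (snd q))) - h 0) * e q) = S z - S (?T 0)"
    by (simp add: S0) (simp add: S_def left_diff_distrib sum_subtractf)
  then show ?thesis using chain total rest by linarith
qed

text \<open>The probabilistic half: a union bound over the links of all levels below \<open>n\<close>.  The configurations
  in the nets are deterministic, so the tail bound for fixed weights applies to every link.\<close>

lemma chaining_event:
  fixes X p :: "nat \<times> nat \<Rightarrow> 'w \<Rightarrow> real"
  assumes M: "prob_space M" and F: "subalgebra M F"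
    and indep: "cond_indep_vars M F (\<lambda>_. borel) X (node_pairs n)"
    and val: "\<And>i \<omega>. i \<in> node_pairs n \<Longrightarrow> \<omega> \<in> space M \<Longrightarrow> X i \<omega> \<in> {0, 1}"
    and cp: "\<And>i. i \<in> node_pairs n \<Longrightarrow>
      AE \<omega> in M. cond_prob_alg M F {\<omega>' \<in> space M. X i \<omega>' = 1} \<omega> = p i \<omega>"
    and p: "\<And>i. i \<in> node_pairs n \<Longrightarrow> p i \<in> borel_measurable F"
    and p01: "\<And>i \<omega>. i \<in> node_pairs n \<Longrightarrow> 0 \<le> p i \<omega> \<and> p i \<omega> \<le> 1"
    and h: "\<And>x y. 0 \<le> x \<Longrightarrow> x \<le> 2 * R \<Longrightarrow> 0 \<le> y \<Longrightarrow> y \<le> 2 * R \<Longrightarrow> \<bar>h x - h y\<bar> \<le> L * \<bar>x\<^sup>2 - y\<^sup>2\<bar>"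
    and L: "0 < L" and R: "R > 0" and n: "n \<ge> 1"
  shows "\<exists>B\<in>sets M. measure M B \<le> 2 * real n * exp (- real n) \<and>
    (\<forall>\<omega>\<in>space M - B. \<forall>k<n. \<forall>(u, v)\<in>net_edges n R k :: ((nat \<Rightarrow> real ^ 'd) \<times> _) set.
      \<bar>\<Sum>q\<in>node_pairs n. pair_diff h u v q * (X q \<omega> - p q \<omega>)\<bar> \<le> step_tail L R (real CARD('d)) n k)"
proof -
  interpret prob_space M by fact
  let ?d = "real CARD('d)"
  let ?t = "step_tail L R ?d n"
  define E where "E k = (net_edges n R k :: ((nat \<Rightarrow> real ^ 'd) \<times> (nat \<Rightarrow> real ^ 'd)) set)" for k
  have X [measurable]: "X i \<in> borel_measurable M" if "i \<in> node_pairs n" for i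
    using indep that by (simp add: cond_indep_vars_def)
  have pM [measurable]: "p i \<in> borel_measurable M" if "i \<in> node_pairs n" for i
    using measurable_from_subalg[OF F p[OF that]] .
  define A where "A k e = {\<omega> \<in> space M.
    ?t k \<le> \<bar>\<Sum>q\<in>node_pairs n. pair_diff h (fst e) (snd e) q * (X q \<omega> - p q \<omega>)\<bar>}"
    for k and e :: "(nat \<Rightarrow> real ^ 'd) \<times> (nat \<Rightarrow> real ^ 'd)"
  have A [measurable]: "A k e \<in> sets M" for k e unfolding A_def by measurable
  define B where "B = (\<Union>k<n. \<Union>e\<in>E k. A k e)"
  have finE: "finite (E k)" for k unfolding E_def by (rule net_edges_finite_card)
  have B: "B \<in> sets M" unfolding B_def by (intro sets.finite_UN) (auto simp: finE)
  have d1: "1 \<le> ?d" by (simp add: Suc_le_eq)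
  have W: "0 < step_size L R ?d k" for k using L R d1 by (simp add: step_size_def)
  have A_le: "measure M (A k e) \<le> 2 * exp (- 2 * (real n * ?d) * (real k + 3)\<^sup>2)" if "e \<in> E k" for k e
  proof -
    let ?w = "pair_diff h (fst e) (snd e)"
    let ?V = "(real n * step_size L R ?d k)\<^sup>2"
    have w: "\<bar>?w q\<bar> \<le> step_size L R ?d k" if q: "q \<in> node_pairs n" for q
    proof -
      have "\<bar>?w q\<bar> \<le> 8 * L * R * (sqrt ?d * (2 * R / 2 ^ k))"
        using L by (intro pair_diff_le[OF h _ _ q]) (use \<open>e \<in> E k\<close> in \<open>auto simp: E_def net_edges_def\<close>)
      then show ?thesis by (simp add: step_size_def power2_eq_square mult_ac)
    qed
    have "(\<Sum>q\<in>node_pairs n. (?w q)\<^sup>2) \<le> (\<Sum>q\<in>node_pairs n. (step_size L R ?d k)\<^sup>2)"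
      using w W[of k] by (intro sum_mono) (simp add: abs_le_square_iff[symmetric])
    also have "\<dots> = real (card (node_pairs n)) * (step_size L R ?d k)\<^sup>2" by simp
    also have "\<dots> \<le> (real n)\<^sup>2 * (step_size L R ?d k)\<^sup>2"
      using card_node_pairs_le[of n]
      by (intro mult_right_mono) (simp_all add: of_nat_power[symmetric] del: of_nat_power)
    also have "\<dots> = ?V" by (simp add: power_mult_distrib)
    finally have V: "(\<Sum>q\<in>node_pairs n. (?w q)\<^sup>2) \<le> ?V" .
    have V0: "0 < ?V" using W[of k] n by simp
    have t0: "0 < ?t k" using W[of k] n d1 by (simp add: step_tail_def)
    have "measure M (A k e) \<le> 2 * exp (- 2 * (?t k)\<^sup>2 / ?V)"
      unfolding A_def
      by (rule cond_indep_binary_tail[OF M F finite_node_pairs indep val cp p p01 V V0 t0])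
    also have "(?t k)\<^sup>2 = ?V * ((real n * ?d) * (real k + 3)\<^sup>2)"
      using d1 by (simp add: step_tail_def power_mult_distrib)
    finally show ?thesis using V0 by (simp add: mult_ac)
  qed
  have level: "measure M (\<Union>e\<in>E k. A k e) \<le> 2 * exp (- real n)" for k
  proof -
    have "measure M (\<Union>e\<in>E k. A k e) \<le> (\<Sum>e\<in>E k. measure M (A k e))"
      by (rule finite_measure_subadditive_finite) (auto simp: finE)
    also have "\<dots> \<le> (\<Sum>e\<in>E k. 2 * exp (- 2 * (real n * ?d) * (real k + 3)\<^sup>2))"
      by (intro sum_mono A_le)
    also have "\<dots> = real (card (E k)) * (2 * exp (- 2 * (real n * ?d) * (real k + 3)\<^sup>2))" by simp
    also have "\<dots> \<le> exp (real ((2 * k + 5) * CARD('d) * n)) * (2 * exp (- 2 * (real n * ?d) * (real k + 3)\<^sup>2))"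
    proof (intro mult_right_mono)
      have "real (card (E k)) \<le> real (2 ^ ((2 * k + 5) * CARD('d) * n))"
        unfolding E_def by (intro of_nat_mono net_edges_finite_card)
      also have "\<dots> = 2 ^ ((2 * k + 5) * CARD('d) * n)" by simp
      also have "\<dots> \<le> exp 1 ^ ((2 * k + 5) * CARD('d) * n)"
        using exp_ge_add_one_self[of 1] by (intro power_mono) auto
      also have "\<dots> = exp (real ((2 * k + 5) * CARD('d) * n))"
        by (simp add: exp_of_nat_mult[symmetric])
      finally show "real (card (E k)) \<le> exp (real ((2 * k + 5) * CARD('d) * n))" .
    qed simp
    also have "\<dots> = 2 * exp ((real n * ?d) * (2 * real k + 5 - 2 * (real k + 3)\<^sup>2))"
      by (simp add: exp_add[symmetric] algebra_simps)
    also have "\<dots> \<le> 2 * exp (- real n)"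
    proof -
      have "2 * real k + 5 - 2 * (real k + 3)\<^sup>2 \<le> - 1"
      proof -
        have "(real k + 3)\<^sup>2 = real k * real k + 6 * real k + 9"
          by (simp add: power2_eq_square algebra_simps)
        moreover have "0 \<le> real k * real k" "0 \<le> real k" by simp_all
        ultimately show ?thesis by linarith
      qed
      then have "(real n * ?d) * (2 * real k + 5 - 2 * (real k + 3)\<^sup>2) \<le> (real n * ?d) * (- 1)"
        by (intro mult_left_mono) auto
      also have "\<dots> \<le> - real n" using d1 mult_left_mono[of 1 ?d "real n"] by simp
      finally show ?thesis by simp
    qed
    finally show ?thesis .
  qed
  have "measure M B \<le> (\<Sum>k<n. measure M (\<Union>e\<in>E k. A k e))"
    unfolding B_def by (rule finite_measure_subadditive_finite) (auto intro!: sets.finite_UN simp: finE)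
  also have "\<dots> \<le> (\<Sum>k<n. 2 * exp (- real n))" by (intro sum_mono level)
  finally have mB: "measure M B \<le> 2 * real n * exp (- real n)" by (simp add: mult_ac)
  have "\<bar>\<Sum>q\<in>node_pairs n. pair_diff h u v q * (X q \<omega> - p q \<omega>)\<bar> \<le> ?t k"
    if "\<omega> \<in> space M - B" "k < n" "(u, v) \<in> E k" for \<omega> k u v
  proof -
    have "\<omega> \<notin> A k (u, v)" using that by (auto simp: B_def)
    then show ?thesis using that by (simp add: A_def)
  qed
  with B mB show ?thesis unfolding E_def by blast
qed

section \<open>The link function\<close>

text \<open>With respect to \<open>x\<^sup>2\<close> the logit of \<open>K\<close> has derivative \<open>K' / (2 x K (1 - K))\<close>, at most
  \<open>A / 2\<close> in absolute value.  Adding and subtracting \<open>A x\<^sup>2 / 2\<close> therefore gives monotone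
  functions; this form also covers \<open>x = 0\<close>, where \<open>K\<close> is only continuous.\<close>

lemma logit_lipschitz_sq:
  fixes K :: "real \<Rightarrow> real"
  assumes K: "\<And>x. 0 \<le> x \<Longrightarrow> x \<le> T \<Longrightarrow> 0 < K x \<and> K x \<le> 1 - \<epsilon>" and \<epsilon>: "0 < \<epsilon>"
    and cont: "continuous_on {0..T} K"
    and der: "\<And>x. 0 < x \<Longrightarrow> x < T \<Longrightarrow> (K has_real_derivative K' x) (at x)"
    and A: "\<And>x. 0 < x \<Longrightarrow> x < T \<Longrightarrow> \<bar>K' x\<bar> \<le> A * (x * K x * \<epsilon>)"
    and x: "0 \<le> x" "x \<le> T" and y: "0 \<le> y" "y \<le> T"
  shows "\<bar>(ln (K x) - ln (1 - K x)) - (ln (K y) - ln (1 - K y))\<bar> \<le> A / 2 * \<bar>x\<^sup>2 - y\<^sup>2\<bar>"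
proof -
  define h where "h x = ln (K x) - ln (1 - K x)" for x
  have mono: "A / 2 * u\<^sup>2 + \<sigma> * h u \<le> A / 2 * v\<^sup>2 + \<sigma> * h v"
    if uv: "0 \<le> u" "u \<le> v" "v \<le> T" and \<sigma>: "\<bar>\<sigma>\<bar> = 1" for u v \<sigma> :: real
  proof (rule DERIV_nonneg_imp_increasing_open[OF uv(2)])
    fix x assume x: "u < x" "x < v"
    then have x': "0 < x" "x < T" using uv by auto
    have Kx: "0 < K x" "\<epsilon> \<le> 1 - K x" using K[of x] x' by auto
    have D: "((\<lambda>u. A / 2 * u\<^sup>2 + \<sigma> * h u) has_real_derivative
        (A * x + \<sigma> * (K' x / K x + K' x / (1 - K x)))) (at x)"
      unfolding h_def using der[OF x'] Kx \<epsilon>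
      by (auto intro!: derivative_eq_intros simp: field_simps)
    have "K' x / K x + K' x / (1 - K x) = K' x / (K x * (1 - K x))"
      using Kx \<epsilon> by (simp add: divide_simps) (simp add: algebra_simps)
    then have "\<bar>\<sigma> * (K' x / K x + K' x / (1 - K x))\<bar> = \<bar>K' x\<bar> / (K x * (1 - K x))"
      using \<sigma> Kx \<epsilon> by (simp add: abs_mult)
    also have "\<dots> \<le> \<bar>K' x\<bar> / (K x * \<epsilon>)"
      using Kx \<epsilon> by (intro divide_left_mono mult_left_mono mult_pos_pos) auto
    also have "\<dots> \<le> A * x"
      using A[OF x'] Kx \<epsilon> by (simp add: pos_divide_le_eq mult_ac)
    finally have "0 \<le> A * x + \<sigma> * (K' x / K x + K' x / (1 - K x))" by linarith
    with D show "\<exists>y. ((\<lambda>u. A / 2 * u\<^sup>2 + \<sigma> * h u) has_real_derivative y) (at x) \<and> 0 \<le> y" by blast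
  next
    have "continuous_on {u..v} K" using cont by (rule continuous_on_subset) (use uv in auto)
    moreover have "K x \<noteq> 0" "1 - K x \<noteq> 0" if "x \<in> {u..v}" for x
      using K[of x] \<epsilon> that uv by auto
    ultimately show "continuous_on {u..v} (\<lambda>u. A / 2 * u\<^sup>2 + \<sigma> * h u)"
      unfolding h_def by (intro continuous_intros) auto
  qed
  have *: "\<bar>h u - h v\<bar> \<le> A / 2 * \<bar>u\<^sup>2 - v\<^sup>2\<bar>" if uv: "0 \<le> u" "u \<le> v" "v \<le> T" for u v
  proof -
    have "u\<^sup>2 \<le> v\<^sup>2" using uv by (simp add: power_mono)
    then have "A / 2 * \<bar>u\<^sup>2 - v\<^sup>2\<bar> = A / 2 * v\<^sup>2 - A / 2 * u\<^sup>2"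
      by (simp add: abs_minus_commute right_diff_distrib diff_divide_distrib)
    moreover have "A / 2 * u\<^sup>2 + h u \<le> A / 2 * v\<^sup>2 + h v" using mono[OF uv, of 1] by simp
    moreover have "A / 2 * u\<^sup>2 - h u \<le> A / 2 * v\<^sup>2 - h v" using mono[OF uv, of "- 1"] by simp
    ultimately show ?thesis by linarith
  qed
  show ?thesis
  proof (cases "x \<le> y")
    case True
    then show ?thesis using *[of x y] x y by (simp add: h_def)
  next
    case False
    then show ?thesis using *[of y x] x y by (simp add: h_def abs_minus_commute)
  qed
qed

text \<open>With respect to \<open>x\<^sup>2\<close> the function \<open>sqrt K\<close> has derivative \<open>K' / (4 x sqrt K)\<close>, at most
  \<open>-1 / (4 sqrt B)\<close>, so it separates squared distances.\<close>

lemma sqrt_link_expands_sq: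
  fixes K :: "real \<Rightarrow> real"
  assumes K: "\<And>x. 0 \<le> x \<Longrightarrow> x \<le> T \<Longrightarrow> 0 < K x"
    and cont: "continuous_on {0..T} K"
    and der: "\<And>x. 0 < x \<Longrightarrow> x < T \<Longrightarrow> (K has_real_derivative K' x) (at x)"
    and neg: "\<And>x. 0 < x \<Longrightarrow> x < T \<Longrightarrow> K' x \<le> 0"
    and B: "\<And>x. 0 < x \<Longrightarrow> x < T \<Longrightarrow> x\<^sup>2 * K x \<le> B * (K' x)\<^sup>2" and "0 < B"
    and x: "0 \<le> x" "x \<le> T" and y: "0 \<le> y" "y \<le> T"
  shows "(x\<^sup>2 - y\<^sup>2)\<^sup>2 \<le> 16 * B * (sqrt (K x) - sqrt (K y))\<^sup>2"
proof -
  define c where "c = 1 / (4 * sqrt B)"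
  have c: "0 < c" using \<open>0 < B\<close> by (simp add: c_def)
  have mono: "sqrt (K v) + c * v\<^sup>2 \<le> sqrt (K u) + c * u\<^sup>2"
    if uv: "0 \<le> u" "u \<le> v" "v \<le> T" for u v
  proof -
    have "- (sqrt (K u) + c * u\<^sup>2) \<le> - (sqrt (K v) + c * v\<^sup>2)"
    proof (rule DERIV_nonneg_imp_increasing_open[OF uv(2)])
      fix x assume x: "u < x" "x < v"
      then have x': "0 < x" "x < T" using uv by auto
      have Kx: "0 < K x" using K[of x] x' by auto
      have D: "((\<lambda>u. - (sqrt (K u) + c * u\<^sup>2)) has_real_derivative
          - (K' x / (2 * sqrt (K x)) + 2 * c * x)) (at x)"
        using der[OF x'] Kx by (auto intro!: derivative_eq_intros simp: field_simps)
      have "sqrt (x\<^sup>2 * K x) \<le> sqrt (B * (K' x)\<^sup>2)" using B[OF x'] by simp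
      then have "x * sqrt (K x) \<le> sqrt B * - K' x"
        using x' neg[OF x'] by (simp add: real_sqrt_mult)
      then have "2 * c * x \<le> - K' x / (2 * sqrt (K x))"
        using Kx \<open>0 < B\<close> by (simp add: c_def field_simps)
      then have "0 \<le> - (K' x / (2 * sqrt (K x)) + 2 * c * x)" by simp
      with D show "\<exists>y. ((\<lambda>u. - (sqrt (K u) + c * u\<^sup>2)) has_real_derivative y) (at x) \<and> 0 \<le> y"
        by blast
    next
      have "continuous_on {u..v} K" using cont by (rule continuous_on_subset) (use uv in auto)
      then show "continuous_on {u..v} (\<lambda>u. - (sqrt (K u) + c * u\<^sup>2))"
        by (intro continuous_intros)
    qed
    then show ?thesis by simp
  qed
  have *: "(u\<^sup>2 - v\<^sup>2)\<^sup>2 \<le> 16 * B * (sqrt (K u) - sqrt (K v))\<^sup>2" if uv: "0 \<le> u" "u \<le> v" "v \<le> T" for u v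
  proof -
    have "u\<^sup>2 \<le> v\<^sup>2" using uv by (simp add: power_mono)
    moreover have "c * (v\<^sup>2 - u\<^sup>2) \<le> sqrt (K u) - sqrt (K v)"
      using mono[OF uv] by (simp add: algebra_simps)
    ultimately have "(c * (v\<^sup>2 - u\<^sup>2))\<^sup>2 \<le> (sqrt (K u) - sqrt (K v))\<^sup>2"
      using c by (intro power_mono) auto
    moreover have "(c * (v\<^sup>2 - u\<^sup>2))\<^sup>2 = (u\<^sup>2 - v\<^sup>2)\<^sup>2 / (16 * B)"
      using \<open>0 < B\<close> by (simp add: c_def power_mult_distrib power_divide power2_commute)
    ultimately show ?thesis using \<open>0 < B\<close> by (simp add: pos_divide_le_eq mult_ac)
  qed
  show ?thesis
  proof (cases "x \<le> y")
    case True
    then show ?thesis using *[of x y] x y by simp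
  next
    case False
    then show ?thesis using *[of y x] x y by (simp add: power2_commute)
  qed
qed

text \<open>From \<open>ln t \<le> t - 1\<close> at \<open>t = sqrt (q / p)\<close>, and likewise for \<open>1 - p\<close> and \<open>1 - q\<close>.\<close>

lemma hellinger_le_kl:
  fixes p q :: real
  assumes "0 < p" "p < 1" "0 < q" "q < 1"
  shows "(sqrt p - sqrt q)\<^sup>2 \<le> p * (ln p - ln q) + (1 - p) * (ln (1 - p) - ln (1 - q))"
proof -
  have *: "2 * a - 2 * (sqrt a * sqrt b) \<le> a * (ln a - ln b)" if "0 < a" "0 < b" for a b :: real
  proof -
    have "ln (sqrt b / sqrt a) = (ln b - ln a) / 2"
      using that by (simp add: ln_div ln_sqrt diff_divide_distrib)
    moreover have "ln (sqrt b / sqrt a) \<le> sqrt b / sqrt a - 1"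
      using that by (intro ln_le_minus_one) simp
    ultimately have "(ln b - ln a) / 2 \<le> sqrt b / sqrt a - 1" by linarith
    then have "a * ((ln b - ln a) / 2) \<le> a * (sqrt b / sqrt a - 1)"
      using that by (intro mult_left_mono) auto
    also have "\<dots> = sqrt a * sqrt b - a"
      using that by (simp add: field_simps)
    finally show ?thesis by (simp add: field_simps)
  qed
  have "0 \<le> (sqrt (1 - p) - sqrt (1 - q))\<^sup>2" by simp
  then show ?thesis using *[of p q] *[of "1 - p" "1 - q"] assms
    by (simp add: power2_diff)
qed

lemma sum_symmetric_node_pairs:
  fixes f :: "nat \<Rightarrow> nat \<Rightarrow> real"
  assumes sym: "\<And>i j. i < n \<Longrightarrow> j < n \<Longrightarrow> f i j = f j i" and diag: "\<And>i. i < n \<Longrightarrow> f i i = 0"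
  shows "(\<Sum>i<n. \<Sum>j<n. f i j) = 2 * (\<Sum>q\<in>node_pairs n. f (fst q) (snd q))"
proof -
  have "(\<Sum>i<n. \<Sum>j<n. f i j)
      = (\<Sum>i<n. \<Sum>j<n. (if i < j then f i j else 0) + (if j < i then f j i else 0))"
    by (intro sum.cong refl) (use sym diag in \<open>auto simp: not_less_iff_gr_or_eq\<close>)
  also have "\<dots> = (\<Sum>i<n. \<Sum>j<n. if i < j then f i j else 0) + (\<Sum>i<n. \<Sum>j<n. if j < i then f j i else 0)"
    by (simp add: sum.distrib)
  also have "(\<Sum>i<n. \<Sum>j<n. if j < i then f j i else 0) = (\<Sum>i<n. \<Sum>j<n. if i < j then f i j else 0)"
    by (rule sum.swap)
  also have "(\<Sum>i<n. \<Sum>j<n. if i < j then f i j else 0)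
      = (\<Sum>q\<in>{..<n} \<times> {..<n}. if fst q < snd q then f (fst q) (snd q) else 0)"
    by (simp add: sum.cartesian_product case_prod_unfold)
  also have "\<dots> = (\<Sum>q\<in>{q \<in> {..<n} \<times> {..<n}. fst q < snd q}. f (fst q) (snd q))"
    by (rule sum.inter_filter[symmetric]) simp
  also have "{q \<in> {..<n} \<times> {..<n}. fst q < snd q} = node_pairs n"
    by (auto simp: node_pairs_def)
  finally show ?thesis by simp
qed

section \<open>The error of the restricted maximum likelihood estimator\<close>

definition real_log_likelihood ::
  "(real \<Rightarrow> real) \<Rightarrow> nat \<Rightarrow> real mat \<Rightarrow> (nat \<Rightarrow> real ^ 'd) \<Rightarrow> real" where
  "real_log_likelihood K n y z = (\<Sum>i<n. \<Sum>j<n.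
     y $$ (i, j) * ln (K (norm (z i - z j))) + (1 - y $$ (i, j)) * ln (1 - K (norm (z i - z j))))"

lemma norm_diff_le_2:
  fixes u v :: "'a::real_normed_vector"
  shows "norm u \<le> R \<Longrightarrow> norm v \<le> R \<Longrightarrow> norm (u - v) \<le> 2 * R"
  using norm_triangle_ineq4[of u v] by simp

lemma log_likelihood_eq_real:
  assumes K: "\<And>x. 0 \<le> x \<Longrightarrow> x \<le> 2 * R \<Longrightarrow> 0 < K x \<and> K x < 1"
    and z: "\<And>i. i < n \<Longrightarrow> norm (z i) \<le> R"
  shows "log_likelihood K n y z = ereal (real_log_likelihood K n y z)"
proof -
  have "K (norm (z i - z j)) \<noteq> 0 \<and> 1 - K (norm (z i - z j)) \<noteq> 0" if "i < n" "j < n" for i j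
    using K[of "norm (z i - z j)"] norm_diff_le_2[OF z[OF that(1)] z[OF that(2)]] by auto
  then have "log_likelihood K n y z = (\<Sum>i<n. \<Sum>j<n. ereal (
     y $$ (i, j) * ln (K (norm (z i - z j))) + (1 - y $$ (i, j)) * ln (1 - K (norm (z i - z j)))))"
    unfolding log_likelihood_def by (intro sum.cong refl) (auto simp: elog_def)
  then show ?thesis by (simp add: real_log_likelihood_def)
qed

text \<open>The deterministic core.  The difference of the log-likelihoods at \<open>zhat\<close> and \<open>z\<close> is a
  centered fluctuation minus a sum of Kullback-Leibler divergences.  Since the former is at most
  \<open>4 T\<close> and the difference is nonnegative, the divergences sum to at most \<open>4 T\<close>.  They dominate
  squared Hellinger distances, these dominate the differences of squared distances through \<open>B\<close>,
  and double centering and \<open>procrustes_bound\<close> finish.\<close>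

lemma mle_procrustes_error_le:
  fixes z zhat :: "nat \<Rightarrow> real ^ 'd" and K :: "real \<Rightarrow> real"
  defines "h \<equiv> \<lambda>x. ln (K x) - ln (1 - K x)"
  assumes n: "n \<ge> 1" and y: "y \<in> adjacency_matrices n"
    and z: "\<And>i. i < n \<Longrightarrow> norm (z i) \<le> R" and zhat: "\<And>i. i < n \<Longrightarrow> norm (zhat i) \<le> R"
    and K: "\<And>x. 0 \<le> x \<Longrightarrow> x \<le> 2 * R \<Longrightarrow> 0 < K x \<and> K x < 1"
    and better: "log_likelihood K n y z \<le> log_likelihood K n y zhat"
    and B: "\<And>x y. 0 \<le> x \<Longrightarrow> x \<le> 2 * R \<Longrightarrow> 0 \<le> y \<Longrightarrow> y \<le> 2 * R \<Longrightarrow>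
      (x\<^sup>2 - y\<^sup>2)\<^sup>2 \<le> 16 * B * (sqrt (K x) - sqrt (K y))\<^sup>2" and "0 < B"
    and ray: "\<And>v. \<mu> * (v \<bullet> v) \<le> (\<Sum>i<n. (centered n z i \<bullet> v)\<^sup>2)" and "0 < \<mu>"
    and dev: "\<And>u :: nat \<Rightarrow> real ^ 'd. (\<And>i. i < n \<Longrightarrow> norm (u i) \<le> R) \<Longrightarrow>
      \<bar>\<Sum>q\<in>node_pairs n. (h (norm (u (fst q) - u (snd q))) - h 0)
        * (y $$ q - K (norm (z (fst q) - z (snd q))))\<bar> \<le> T"
  shows "procrustes_error n zhat z \<le> 32 * B * T / \<mu>"
proof -
  define x where "x i j = norm (z i - z j)" for i j
  define w where "w i j = norm (zhat i - zhat j)" for i j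
  have x: "0 \<le> x i j" "x i j \<le> 2 * R" if "i < n" "j < n" for i j
    using norm_diff_le_2[OF z[OF that(1)] z[OF that(2)]] by (auto simp: x_def)
  have w: "0 \<le> w i j" "w i j \<le> 2 * R" if "i < n" "j < n" for i j
    using norm_diff_le_2[OF zhat[OF that(1)] zhat[OF that(2)]] by (auto simp: w_def)
  have ysym: "y $$ (i, j) = y $$ (j, i)" if "i < n" "j < n" for i j
    using y that by (auto simp: adjacency_matrices_def)
  define e where "e q = y $$ q - K (norm (z (fst q) - z (snd q)))" for q
  define S where "S u = (\<Sum>q\<in>node_pairs n. (h (norm (u (fst q) - u (snd q))) - h 0) * e q)"
    for u :: "nat \<Rightarrow> real ^ 'd"
  define kl where "kl i j = K (x i j) * (ln (K (x i j)) - ln (K (w i j)))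
    + (1 - K (x i j)) * (ln (1 - K (x i j)) - ln (1 - K (w i j)))" for i j
  have "real_log_likelihood K n y z \<le> real_log_likelihood K n y zhat"
    using better by (simp add: log_likelihood_eq_real[OF K z] log_likelihood_eq_real[OF K zhat])
  then have "0 \<le> real_log_likelihood K n y zhat - real_log_likelihood K n y z" by simp
  also have "\<dots> = (\<Sum>i<n. \<Sum>j<n. (h (w i j) - h (x i j)) * e (i, j) - kl i j)"
    unfolding real_log_likelihood_def sum_subtractf[symmetric]
    by (intro sum.cong refl) (simp add: h_def e_def kl_def x_def w_def algebra_simps)
  also have "\<dots> = (\<Sum>i<n. \<Sum>j<n. (h (w i j) - h (x i j)) * e (i, j)) - (\<Sum>i<n. \<Sum>j<n. kl i j)"
    by (simp add: sum_subtractf)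
  \<comment> \<open>The diagonal contributes nothing, as both distances vanish there.\<close>
  also have "(\<Sum>i<n. \<Sum>j<n. (h (w i j) - h (x i j)) * e (i, j))
      = 2 * (\<Sum>q\<in>node_pairs n. (h (w (fst q) (snd q)) - h (x (fst q) (snd q))) * e q)"
    by (subst sum_symmetric_node_pairs)
      (auto simp: e_def w_def x_def ysym norm_minus_commute)
  also have "(\<Sum>q\<in>node_pairs n. (h (w (fst q) (snd q)) - h (x (fst q) (snd q))) * e q) = S zhat - S z"
    unfolding S_def sum_subtractf[symmetric]
    by (intro sum.cong refl) (simp add: w_def x_def algebra_simps)
  also have "S zhat - S z \<le> 2 * T"
    using dev[of zhat] dev[of z] z zhat by (simp add: S_def e_def)
  finally have kl: "(\<Sum>i<n. \<Sum>j<n. kl i j) \<le> 4 * T" by simp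
  have "4 * (\<Sum>i<n. \<Sum>j<n. (centered n zhat i \<bullet> centered n zhat j - centered n z i \<bullet> centered n z j)\<^sup>2)
      \<le> (\<Sum>i<n. \<Sum>j<n. ((w i j)\<^sup>2 - (x i j)\<^sup>2)\<^sup>2)"
    unfolding w_def x_def using n by (intro centered_gram_diff_le) simp
  also have "\<dots> \<le> (\<Sum>i<n. \<Sum>j<n. 16 * B * kl i j)"
  proof (intro sum_mono)
    fix i j assume ij: "i \<in> {..<n}" "j \<in> {..<n}"
    have "((w i j)\<^sup>2 - (x i j)\<^sup>2)\<^sup>2 \<le> 16 * B * (sqrt (K (x i j)) - sqrt (K (w i j)))\<^sup>2"
      using B[of "x i j" "w i j"] x[of i j] w[of i j] ij by (simp add: power2_commute)
    also have "\<dots> \<le> 16 * B * kl i j"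
      unfolding kl_def using K[of "x i j"] K[of "w i j"] x[of i j] w[of i j] ij \<open>0 < B\<close>
      by (intro mult_left_mono hellinger_le_kl) auto
    finally show "((w i j)\<^sup>2 - (x i j)\<^sup>2)\<^sup>2 \<le> 16 * B * kl i j" .
  qed
  also have "\<dots> \<le> 16 * B * (4 * T)"
    using kl \<open>0 < B\<close> by (simp add: sum_distrib_left[symmetric])
  finally have gram: "(\<Sum>i<n. \<Sum>j<n. (centered n zhat i \<bullet> centered n zhat j - centered n z i \<bullet> centered n z j)\<^sup>2)
      \<le> 16 * B * T" by simp
  obtain U :: "real ^ 'd ^ 'd" where U: "orthogonal_matrix U"
    and U_le: "\<mu> * (\<Sum>i<n. (norm (centered n zhat i v* U - centered n z i))\<^sup>2)
      \<le> 2 * (\<Sum>i<n. \<Sum>j<n. (centered n zhat i \<bullet> centered n zhat j - centered n z i \<bullet> centered n z j)\<^sup>2)"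
    using procrustes_bound[where I = "{..<n}" and a = "centered n z" and b = "centered n zhat", OF ray]
    by blast
  define mean where "mean u = (1 / real n) *\<^sub>R (\<Sum>k<n. u k)" for u :: "nat \<Rightarrow> real ^ 'd"
  define c :: "nat \<Rightarrow> real ^ 'd" where "c i = mean zhat v* U - mean z" for i
  have diff: "zhat i v* U - z i - c i = centered n zhat i v* U - centered n z i" for i
    unfolding c_def centered_def mean_def[symmetric] by (simp add: vector_matrix_mult_diff_distrib)
  have "procrustes_error n zhat z \<le> (frobenius_norm n (\<lambda>i. zhat i v* U - z i - c i))\<^sup>2"
    unfolding procrustes_error_def
  proof (rule cINF_lower2)
    show "(U, c) \<in> {U. orthogonal_matrix U} \<times> identical_rows n"
      using U by (auto simp: identical_rows_def c_def)
    show "bdd_below ((\<lambda>(U, q). (frobenius_norm n (\<lambda>i. zhat i v* U - z i - q i))\<^sup>2) `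
        ({U. orthogonal_matrix U} \<times> identical_rows n))"
      by (rule bdd_belowI2[of _ 0]) auto
  qed simp
  also have "\<dots> = (\<Sum>i<n. (norm (centered n zhat i v* U - centered n z i))\<^sup>2)"
    unfolding diff frobenius_norm_def
    by (simp add: sum_nonneg norm_vec_def L2_set_def)
  also have "\<dots> \<le> 32 * B * T / \<mu>"
    using U_le gram \<open>0 < \<mu>\<close> by (simp add: pos_le_divide_eq mult.commute)
  finally show ?thesis .
qed

lemma ext_quot_le_ennreal:
  assumes "ext_quot p q \<le> ennreal c" "0 \<le> c"
  shows "q \<noteq> 0" "p / q \<le> c"
proof -
  show q: "q \<noteq> 0"
  proof
    assume "q = 0"
    then have "ext_quot p q = \<infinity>" by (simp add: ext_quot_def)
    with assms(1) show False by (simp add: top_unique)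
  qed
  with assms show "p / q \<le> c" by (simp add: ext_quot_def ennreal_le_iff)
qed

lemma
  assumes "alpha_K K \<epsilon> G n = ennreal A" "0 \<le> A" "0 < x" "x \<le> 2 * G (real n)" "0 \<le> K x" "0 < \<epsilon>"
  shows alpha_K_pos: "0 < K x" and alpha_K_bound: "\<bar>deriv K x\<bar> \<le> A * (x * K x * \<epsilon>)"
proof -
  have "ext_quot \<bar>deriv K x\<bar> (\<bar>x\<bar> * K x * \<epsilon>) \<le> alpha_K K \<epsilon> G n"
    unfolding alpha_K_def by (rule SUP_upper) (use assms in auto)
  then have q: "ext_quot \<bar>deriv K x\<bar> (\<bar>x\<bar> * K x * \<epsilon>) \<le> ennreal A" using assms by simp
  note * = ext_quot_le_ennreal[OF q \<open>0 \<le> A\<close>]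
  show "0 < K x" using *(1) assms by auto
  then have "0 < x * K x * \<epsilon>" using assms by simp
  then show "\<bar>deriv K x\<bar> \<le> A * (x * K x * \<epsilon>)" using *(2) assms by (simp add: pos_divide_le_eq)
qed

lemma
  assumes "beta_K K G n = ennreal B" "0 \<le> B" "0 < x" "x \<le> 2 * G (real n)"
  shows beta_K_nonzero: "deriv K x \<noteq> 0" and beta_K_bound: "x\<^sup>2 * K x \<le> B * (deriv K x)\<^sup>2"
proof -
  have "ext_quot (x\<^sup>2 * K x) ((deriv K x)\<^sup>2) \<le> beta_K K G n"
    unfolding beta_K_def by (rule SUP_upper) (use assms in auto)
  then have q: "ext_quot (x\<^sup>2 * K x) ((deriv K x)\<^sup>2) \<le> ennreal B" using assms by simp
  note * = ext_quot_le_ennreal[OF q \<open>0 \<le> B\<close>]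
  show "deriv K x \<noteq> 0" using *(1) by simp
  then show "x\<^sup>2 * K x \<le> B * (deriv K x)\<^sup>2" using *(2) by (simp add: pos_divide_le_eq)
qed

lemma deriv_nonpos_of_antimono:
  fixes K :: "real \<Rightarrow> real"
  assumes "antimono_on {0..} K" "(K has_real_derivative D) (at x)" "0 < x"
  shows "D \<le> 0"
proof -
  have "mono_on {0..} (\<lambda>x. - K x)"
    using assms(1) by (auto simp: monotone_on_def)
  moreover have "((\<lambda>x. - K x) has_real_derivative - D) (at x)"
    using assms(2) by (rule DERIV_minus)
  moreover have "x \<in> interior {0..}" using assms(3) by simp
  ultimately have "0 \<le> - D" by (rule mono_on_imp_deriv_nonneg)
  then show ?thesis by simp
qed

lemma subalgebra_latent_algebra:
  assumes "\<And>i. i < n \<Longrightarrow> (\<lambda>\<omega>. Z \<omega> i) \<in> borel_measurable M"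
  shows "subalgebra M (latent_algebra M n Z)"
proof -
  have "(\<lambda>\<omega>. \<lambda>i\<in>{..<n}. Z \<omega> i) \<in> measurable M (\<Pi>\<^sub>M i\<in>{..<n}. borel)"
    by (rule measurable_restrict) (use assms in simp)
  from sets_image_in_sets[OF refl this] show ?thesis
    by (simp add: subalgebra_def latent_algebra_def)
qed

lemma latent_measurable:
  assumes "i < n"
  shows "(\<lambda>\<omega>. Z \<omega> i) \<in> borel_measurable (latent_algebra M n Z)"
proof -
  let ?f = "\<lambda>\<omega>. \<lambda>i\<in>{..<n}. Z \<omega> i"
  have "?f \<in> measurable (latent_algebra M n Z) (\<Pi>\<^sub>M i\<in>{..<n}. borel)"
    unfolding latent_algebra_def by (rule measurable_vimage_algebra1) (auto simp: space_PiM)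
  from measurable_compose[OF this measurable_component_singleton[of i]] assms
  show ?thesis by simp
qed

text \<open>From \<open>exp (n / 3) \<ge> n / 3\<close>, cubed.\<close>

lemma exp_minus_nat_le:
  assumes "n \<ge> 1"
  shows "2 * real n * exp (- real n) \<le> 54 / (real n)\<^sup>2"
proof -
  have "(real n / 3) ^ 3 \<le> exp (real n / 3) ^ 3"
    using exp_ge_add_one_self[of "real n / 3"] by (intro power_mono) linarith+
  also have "\<dots> = exp (real n)" by (simp add: exp_of_nat_mult[symmetric])
  finally have "real n ^ 3 \<le> 27 * exp (real n)" by (simp add: power_divide)
  then have "2 * real n * (real n)\<^sup>2 \<le> 54 * exp (real n)"
    by (simp add: power2_eq_square power3_eq_cube)
  then show ?thesis using assms by (simp add: exp_minus field_simps)
qed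

text \<open>An infinite threshold makes the error event empty.  The last two hypotheses exclude a product
  that is \<open>0\<close>, so that \<open>b = 0\<close> gives \<open>\<infinity>\<close> and not the indeterminate \<open>0 / 0\<close>.\<close>
lemma error_bound_cases:
  fixes c g b a :: real and \<alpha> \<beta> :: ennreal
  assumes "0 < c" "0 < g" "0 \<le> b" "\<alpha> = 0 \<Longrightarrow> \<beta> = \<infinity>" "\<beta> = 0 \<Longrightarrow> \<alpha> = \<infinity>"
  obtains "ereal a + ereal c * enn2ereal (ext_prod \<alpha> \<beta>) * ereal g / ereal b = \<infinity>"
  | A B where "\<alpha> = ennreal A" "\<beta> = ennreal B" "0 < A" "0 < B" "0 < b"
    "ereal a + ereal c * enn2ereal (ext_prod \<alpha> \<beta>) * ereal g / ereal b = ereal (a + c * (A * B) * g / b)"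
proof (cases "\<alpha> = \<infinity> \<or> \<beta> = \<infinity>")
  case True
  then have "ext_prod \<alpha> \<beta> = \<infinity>" by (auto simp: ext_prod_def)
  then have "ereal c * enn2ereal (ext_prod \<alpha> \<beta>) * ereal g / ereal b = \<infinity>"
    using assms by (cases "b = 0") (simp_all add: divide_ereal_def)
  then show thesis using that(1) by simp
next
  case False
  then obtain A B where AB: "\<alpha> = ennreal A" "0 \<le> A" "\<beta> = ennreal B" "0 \<le> B"
    by (cases \<alpha>; cases \<beta>) auto
  with assms(4,5) have pos: "0 < A" "0 < B" by (auto simp: less_le)
  have "enn2ereal (ext_prod \<alpha> \<beta>) = ereal (A * B)"
    using AB by (simp add: ext_prod_def ennreal_mult[symmetric] enn2ereal_ennreal)
  then have eq: "ereal c * enn2ereal (ext_prod \<alpha> \<beta>) * ereal g = ereal (c * (A * B) * g)" by simp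
  show thesis
  proof (cases "b = 0")
    case True
    have "ereal (c * (A * B) * g) / ereal b = \<infinity>"
      using True assms(1,2) pos by (auto simp: divide_ereal_def)
    then show thesis using that(1) by (simp add: eq)
  next
    case False
    then show thesis
      by (intro that(2)[OF AB(1,3) pos]) (use \<open>0 \<le> b\<close> in \<open>simp_all add: eq\<close>)
  qed
qed

text \<open>At \<open>x = G n\<close>, a vanishing numerator of one quotient is a vanishing denominator of the other.\<close>

lemma ext_alpha_beta_zero:
  assumes G: "0 < G (real n)" and K: "\<And>x. 0 < x \<Longrightarrow> 0 \<le> K x" and \<epsilon>: "0 < \<epsilon>"
  shows "alpha_K K \<epsilon> G n = 0 \<Longrightarrow> beta_K K G n = \<infinity>"
    and "beta_K K G n = 0 \<Longrightarrow> alpha_K K \<epsilon> G n = \<infinity>"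
proof -
  let ?x = "G (real n)"
  show "beta_K K G n = \<infinity>" if "alpha_K K \<epsilon> G n = 0"
  proof (rule ccontr)
    assume "beta_K K G n \<noteq> \<infinity>"
    then obtain B where B: "beta_K K G n = ennreal B" "0 \<le> B" by (cases "beta_K K G n") auto
    have "deriv K ?x \<noteq> 0" using beta_K_nonzero[OF B, of ?x] G by simp
    moreover have "\<bar>deriv K ?x\<bar> \<le> 0 * (?x * K ?x * \<epsilon>)"
      using alpha_K_bound[of K \<epsilon> G n 0 ?x] that G K \<epsilon> by simp
    ultimately show False by simp
  qed
  show "alpha_K K \<epsilon> G n = \<infinity>" if "beta_K K G n = 0"
  proof (rule ccontr)
    assume "alpha_K K \<epsilon> G n \<noteq> \<infinity>"
    then obtain A where A: "alpha_K K \<epsilon> G n = ennreal A" "0 \<le> A" by (cases "alpha_K K \<epsilon> G n") auto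
    have "0 < K ?x" using alpha_K_pos[OF A, of ?x] G K \<epsilon> by simp
    moreover have "?x\<^sup>2 * K ?x \<le> 0 * (deriv K ?x)\<^sup>2"
      using beta_K_bound[of K G n 0 ?x] that G by simp
    ultimately show False using G by (simp add: mult_le_0_iff)
  qed
qed

theorem lemma3:
  fixes M :: "nat \<Rightarrow> 'w measure"
    and S :: "(real ^ 'd) set"
    and K G :: "real \<Rightarrow> real"
    and \<epsilon> :: real
    and Z :: "nat \<Rightarrow> 'w \<Rightarrow> nat \<Rightarrow> real ^ 'd"
    and Y :: "nat \<Rightarrow> 'w \<Rightarrow> real mat"
    and a b :: "nat \<Rightarrow> real"
    and Zhat :: "nat \<Rightarrow> real mat \<Rightarrow> nat \<Rightarrow> real ^ 'd"
  assumes "regular_lpm M S K \<epsilon> G Z Y"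
    and "distinctly_bunched M Z a b"
    and "\<And>n. n > CARD('d) \<Longrightarrow> b n \<ge> 0"
    and "\<And>n. n \<ge> 1 \<Longrightarrow> AE \<omega> in M n. \<forall>i<n. norm (Z n \<omega> i) \<le> G (real n)"
    and "restricted_mle K G Zhat"
  shows "\<exists>C>0. \<forall>n\<ge>1.
    measure (M n) {\<omega> \<in> space (M n).
      ereal (procrustes_error n (Zhat n (Y n \<omega>)) (Z n \<omega>)) \<ge>
        ereal (3 * (real CARD('d) - 1) * a n) +
        ereal (50 * (real CARD('d) + 2) * 2 ^ 9 * exp 1)
          * enn2ereal (ext_prod (alpha_K K \<epsilon> G n) (beta_K K G n))
          * ereal ((G (real n))\<^sup>2 * real n powr (3 / 2)) / ereal (b n)}
    \<le> C / (real n)\<^sup>2"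
proof -
  let ?d = "real CARD('d)"
  let ?c = "50 * (?d + 2) * 2 ^ 9 * exp 1"
  let ?bd = "\<lambda>n. ereal (3 * (?d - 1) * a n) + ereal ?c
      * enn2ereal (ext_prod (alpha_K K \<epsilon> G n) (beta_K K G n))
      * ereal ((G (real n))\<^sup>2 * real n powr (3 / 2)) / ereal (b n)"
  let ?Ev = "\<lambda>n. {\<omega> \<in> space (M n).
      ereal (procrustes_error n (Zhat n (Y n \<omega>)) (Z n \<omega>)) \<ge> ?bd n}"
  have lpm: "lpm M S K Z Y" and anti: "antimono_on {0..} K" and diff: "K differentiable_on {0..}"
    and \<epsilon>: "0 < \<epsilon>" and K_le: "\<And>x. 0 \<le> x \<Longrightarrow> K x \<le> 1 - \<epsilon>"
    using assms(1) by (auto simp: regular_lpm_def)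
  have K01: "0 \<le> K x" "K x \<le> 1" if "0 \<le> x" for x using lpm that by (auto simp: lpm_def)
  have cont: "continuous_on {0..} K" using diff by (rule differentiable_imp_continuous_on)
  have der: "(K has_real_derivative deriv K x) (at x)" if "0 < x" for x
  proof -
    have "K differentiable (at x)"
      using diff that unfolding differentiable_on_def
      by (metis at_within_interior atLeast_iff interior_real_atLeast greaterThan_iff less_imp_le)
    then show ?thesis using field_differentiable_derivI real_differentiable_def field_differentiable_def by metis
  qed
  have neg: "deriv K x \<le> 0" if "0 < x" for x
    using deriv_nonpos_of_antimono[OF anti der that] that by blast
  have d1: "1 \<le> ?d" by (simp add: Suc_le_eq)
  obtain k i where k: "k \<in> {1..CARD('d)}" and i1: "i 1 = 1" and i_mono: "\<And>j. j \<in> {1..k} \<Longrightarrow> i j < i (j + 1)"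
    and i_last: "i (k + 1) = CARD('d) + 1"
    and bunched: "\<And>n. n > CARD('d) \<Longrightarrow> AE \<omega> in M n.
           length (nonzero_eigenvalues (centered_gram n (Z n \<omega>))) = CARD('d) \<and>
           (\<forall>j\<in>{1..k}.
              (lam n (Z n \<omega>) (i (j + 1) - 1) - lam n (Z n \<omega>) (i j))\<^sup>2
                / lam n (Z n \<omega>) (i (j + 1) - 1) \<le> a n \<and>
              (lam n (Z n \<omega>) (i (j + 1) - 1) - lam n (Z n \<omega>) (i (j + 1)))\<^sup>2
                / lam n (Z n \<omega>) (i j) \<ge> b n)"
    using assms(2) unfolding distinctly_bunched_def by blast
  have i_ge1: "1 \<le> i j" if "1 \<le> j" "j \<le> k" for j
    using that
  proof (induction j rule: dec_induct)
    case (step m)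
    then show ?case using i_mono[of m] by simp
  qed (use i1 in simp)
  have ik: "1 \<le> i k" "i k < i (k + 1)" using i_ge1[of k] i_mono[of k] k by auto
  have large: "measure (M n) (?Ev n) \<le> 54 / (real n)\<^sup>2" if n: "n > CARD('d)" for n
  proof -
    define R where "R = G (real n)"
    have n1: "n \<ge> 1" using n by simp
    have M: "prob_space (M n)" using lpm n1 by (simp add: lpm_def)
    interpret prob_space "M n" by fact
    have good: "AE \<omega> in M n. 0 < lam n (Z n \<omega>) CARD('d) \<and> b n \<le> lam n (Z n \<omega>) CARD('d) \<and> 0 \<le> a n \<and>
        (\<forall>v. lam n (Z n \<omega>) CARD('d) * (v \<bullet> v) \<le> (\<Sum>i<n. (centered n (Z n \<omega>) i \<bullet> v)\<^sup>2)) \<and>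
        (\<forall>i<n. norm (Z n \<omega> i) \<le> R)"
      using bunched[OF n] assms(4)[OF n1]
    proof eventually_elim
      case (elim \<omega>)
      then have len: "length (nonzero_eigenvalues (centered_gram n (Z n \<omega>))) = CARD('d)" by blast
      have n0: "n > 0" using n1 by simp
      note least = least_eigenvalue_rayleigh[OF n0 len]
      have "b n \<le> lam n (Z n \<omega>) CARD('d)"
        using elim k by (intro last_bunch_gap_le_least_eigenvalue[OF n0 len ik i_last]) auto
      moreover have "0 \<le> (lam n (Z n \<omega>) CARD('d) - lam n (Z n \<omega>) (i k))\<^sup>2 / lam n (Z n \<omega>) CARD('d)"
        using least(1) by simp
      moreover have "(lam n (Z n \<omega>) CARD('d) - lam n (Z n \<omega>) (i k))\<^sup>2 / lam n (Z n \<omega>) CARD('d) \<le> a n"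
        using elim k i_last by (auto dest: bspec[of _ _ k])
      moreover from calculation(2,3) have "0 \<le> a n" by (rule order_trans)
      ultimately show ?case using least elim by (simp add: R_def)
    qed
    \<comment> \<open>Otherwise all positions are \<open>0\<close> and there is no nonzero eigenvalue.\<close>
    have R: "0 < R"
    proof (rule ccontr)
      assume "\<not> 0 < R"
      have "AE \<omega> in M n. False"
        using good
      proof eventually_elim
        case (elim \<omega>)
        have Z0: "Z n \<omega> i = 0" if "i < n" for i
          using elim that \<open>\<not> 0 < R\<close> by (metis norm_le_zero_iff not_less order_trans)
        let ?e = "axis undefined 1 :: real ^ 'd"
        have "lam n (Z n \<omega>) CARD('d) * (?e \<bullet> ?e) \<le> (\<Sum>i<n. (centered n (Z n \<omega>) i \<bullet> ?e)\<^sup>2)"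
          using elim by blast
        also have "\<dots> = 0" by (simp add: centered_def Z0)
        finally show False using elim by (simp add: inner_axis_axis)
      qed
      then show False by simp
    qed
    have "AE \<omega> in M n. 0 \<le> a n" using good by eventually_elim simp
    then have a0: "0 \<le> a n" by simp
    have b0: "0 \<le> b n" using assms(3) n by simp
    have g: "0 < (G (real n))\<^sup>2 * real n powr (3 / 2)" using R n1 by (simp add: R_def)
    have c: "0 < ?c" by (simp add: add_pos_nonneg)
    note zero = ext_alpha_beta_zero[of G n K \<epsilon>, OF R[unfolded R_def] K01(1)[OF less_imp_le] \<epsilon>]
    show ?thesis
    proof (rule error_bound_cases[OF c g b0 zero, of "3 * (?d - 1) * a n"])
      assume "?bd n = \<infinity>"
      then have "?Ev n = {}" by simp
      then show ?thesis by (simp only: measure_empty) simp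
    next
      fix A B assume alpha: "alpha_K K \<epsilon> G n = ennreal A" and beta: "beta_K K G n = ennreal B"
        and A: "0 < A" and B: "0 < B" and b: "0 < b n"
        and bd: "?bd n = ereal (3 * (?d - 1) * a n + ?c * (A * B) * ((G (real n))\<^sup>2 * real n powr (3 / 2)) / b n)"
      have Kpos: "0 < K x \<and> K x \<le> 1 - \<epsilon>" if x: "0 \<le> x" "x \<le> 2 * R" for x
      proof -
        have "0 < K (2 * R)"
          using alpha_K_pos[OF alpha, of "2 * R"] A R K01(1) \<epsilon> by (simp add: R_def)
        also have "K (2 * R) \<le> K x" using anti x R by (auto simp: monotone_on_def)
        finally show ?thesis using K_le x by simp
      qed
      have K1: "0 < K x \<and> K x < 1" if "0 \<le> x" "x \<le> 2 * R" for x
        using Kpos[OF that] \<epsilon> by simp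
      have contR: "continuous_on {0..2 * R} K" using cont by (rule continuous_on_subset) auto
      define h where "h x = ln (K x) - ln (1 - K x)" for x
      have h: "\<bar>h x - h y\<bar> \<le> A / 2 * \<bar>x\<^sup>2 - y\<^sup>2\<bar>"
        if "0 \<le> x" "x \<le> 2 * R" "0 \<le> y" "y \<le> 2 * R" for x y
        unfolding h_def
        by (rule logit_lipschitz_sq[where T = "2 * R" and K' = "deriv K", OF Kpos \<epsilon> contR der _ that])
          (use alpha_K_bound[OF alpha] A K01(1) \<epsilon> in \<open>auto simp: R_def\<close>)
      have sq: "(x\<^sup>2 - y\<^sup>2)\<^sup>2 \<le> 16 * B * (sqrt (K x) - sqrt (K y))\<^sup>2"
        if "0 \<le> x" "x \<le> 2 * R" "0 \<le> y" "y \<le> 2 * R" for x y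
        by (rule sqrt_link_expands_sq[where T = "2 * R" and K' = "deriv K", OF _ contR der neg _ B that])
          (use Kpos beta_K_bound[OF beta] B in \<open>auto simp: R_def\<close>)
      define F where "F = latent_algebra (M n) n (Z n)"
      define X where "X = (\<lambda>(i, j) \<omega>. Y n \<omega> $$ (i, j))"
      define p where "p q \<omega> = K (norm (Z n \<omega> (fst q) - Z n \<omega> (snd q)))" for q \<omega>
      have F: "subalgebra (M n) F"
        unfolding F_def using lpm n1 by (intro subalgebra_latent_algebra) (auto simp: lpm_def)
      have indep: "cond_indep_vars (M n) F (\<lambda>_. borel) X (node_pairs n)"
        using lpm n1 by (simp add: lpm_def F_def X_def node_pairs_def)
      have Yn: "Y n \<omega> \<in> adjacency_matrices n" if "\<omega> \<in> space (M n)" for \<omega>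
        using lpm n1 that by (simp add: lpm_def)
      have val: "X q \<omega> \<in> {0, 1}" if mem: "q \<in> node_pairs n" and \<omega>: "\<omega> \<in> space (M n)" for q \<omega>
      proof -
        obtain i j where q: "q = (i, j)" "i < n" "j < n" using mem by (auto simp: node_pairs_def)
        then have "Y n \<omega> $$ (i, j) \<in> {0, 1}"
          using Yn[OF \<omega>] unfolding adjacency_matrices_def by blast
        then show ?thesis by (simp add: X_def q)
      qed
      have cp: "AE \<omega> in M n. cond_prob_alg (M n) F {\<omega>' \<in> space (M n). X q \<omega>' = 1} \<omega> = p q \<omega>"
        if "q \<in> node_pairs n" for q
        using lpm n1 that by (auto simp: lpm_def F_def X_def p_def node_pairs_def)
      have pF: "p q \<in> borel_measurable F" if "q \<in> node_pairs n" for q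
      proof -
        have "continuous_on UNIV (\<lambda>x. K (max 0 x))"
          by (rule continuous_on_compose2[OF cont]) (auto intro!: continuous_intros)
        then have [measurable]: "(\<lambda>x. K (max 0 x)) \<in> borel_measurable borel"
          by (rule borel_measurable_continuous_onI)
        have [measurable]: "(\<lambda>\<omega>. Z n \<omega> (fst q)) \<in> borel_measurable F" "(\<lambda>\<omega>. Z n \<omega> (snd q)) \<in> borel_measurable F"
          using that unfolding F_def by (auto intro!: latent_measurable simp: node_pairs_def)
        have "(\<lambda>\<omega>. K (max 0 (norm (Z n \<omega> (fst q) - Z n \<omega> (snd q))))) \<in> borel_measurable F"
          by measurable
        then show ?thesis by (simp add: p_def[abs_def])
      qed
      have p01: "0 \<le> p q \<omega> \<and> p q \<omega> \<le> 1" for q \<omega> using K01 by (simp add: p_def)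
      have L: "0 < A / 2" using A by simp
      obtain E where E: "E \<in> sets (M n)" "measure (M n) E \<le> 2 * real n * exp (- real n)"
        and E_good: "\<forall>\<omega>\<in>space (M n) - E. \<forall>k<n. \<forall>(u, v)\<in>net_edges n R k :: ((nat \<Rightarrow> real ^ 'd) \<times> _) set.
          \<bar>\<Sum>q\<in>node_pairs n. pair_diff h u v q * (X q \<omega> - p q \<omega>)\<bar> \<le> step_tail (A / 2) R ?d n k"
        using chaining_event[where h = h and L = "A / 2" and R = R,
              OF M F indep val cp pF p01 h L R n1] by blast
      have "AE \<omega> in M n. \<omega> \<in> ?Ev n \<longrightarrow> \<omega> \<in> E"
        using good AE_space
      proof eventually_elim
        case (elim \<omega>)
        let ?z = "Z n \<omega>" and ?zh = "Zhat n (Y n \<omega>)" and ?l = "lam n (Z n \<omega>) CARD('d)"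
        let ?g = "real n * sqrt (real n)"
        show ?case
        proof (rule impI, rule ccontr)
          assume Ev: "\<omega> \<in> ?Ev n" and notE: "\<omega> \<notin> E"
          have \<omega>: "\<omega> \<in> space (M n)" and z: "\<And>i. i < n \<Longrightarrow> norm (?z i) \<le> R" using elim by auto
          have mle: "is_arg_max (log_likelihood K n (Y n \<omega>)) (\<lambda>z. \<forall>i<n. norm (z i) \<le> R) ?zh"
            using assms(5) n1 Yn[OF \<omega>] by (simp add: restricted_mle_def R_def)
          then have zh: "\<And>i. i < n \<Longrightarrow> norm (?zh i) \<le> R"
            and better: "log_likelihood K n (Y n \<omega>) ?z \<le> log_likelihood K n (Y n \<omega>) ?zh"
            using z by (auto simp: is_arg_max_def not_less)
          let ?T = "144 * (A / 2) * R\<^sup>2 * ?d * ?g"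
          have dev: "\<bar>\<Sum>q\<in>node_pairs n. (h (norm (u (fst q) - u (snd q))) - h 0)
              * (Y n \<omega> $$ q - K (norm (?z (fst q) - ?z (snd q))))\<bar> \<le> ?T"
            if u: "\<And>i. i < n \<Longrightarrow> norm (u i) \<le> R" for u :: "nat \<Rightarrow> real ^ 'd"
          proof (rule chaining_bound[OF h _ R n1 u])
            fix q assume q: "q \<in> node_pairs n"
            show "\<bar>Y n \<omega> $$ q - K (norm (?z (fst q) - ?z (snd q)))\<bar> \<le> 1"
              using val[OF q \<omega>] p01[of q \<omega>] by (auto simp: X_def p_def case_prod_unfold)
          next
            fix k and u v :: "nat \<Rightarrow> real ^ 'd" assume "k < n" "(u, v) \<in> net_edges n R k"
            then show "\<bar>\<Sum>q\<in>node_pairs n. pair_diff h u v q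
                * (Y n \<omega> $$ q - K (norm (?z (fst q) - ?z (snd q))))\<bar> \<le> step_tail (A / 2) R ?d n k"
              using bspec[OF E_good, of \<omega>] \<omega> notE by (fastforce simp: X_def p_def case_prod_unfold)
          qed (use A in auto)
          have "procrustes_error n ?zh ?z \<le> 32 * B * ?T / ?l"
            by (rule mle_procrustes_error_le[OF n1 Yn[OF \<omega>] z zh K1 better sq B])
              (use elim dev in \<open>auto simp: h_def\<close>)
          also have "\<dots> \<le> 32 * B * ?T / b n"
            using elim b B A by (intro divide_left_mono mult_pos_pos) auto
          \<comment> \<open>\<open>32 * 144 / 2 = 2304\<close>, far below the constant \<open>50 * 2 ^ 9\<close> of the claim.\<close>
          also have "\<dots> = 2304 * ?d * ((A * B) * (R\<^sup>2 * ?g)) / b n" by simp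
          also have "\<dots> < ?c * ((A * B) * (R\<^sup>2 * ?g)) / b n"
          proof (intro divide_strict_right_mono mult_strict_right_mono)
            have "50 * (?d + 2) * 2 ^ 9 * 1 \<le> ?c" by (intro mult_left_mono) auto
            moreover have "2304 * ?d < 50 * (?d + 2) * 2 ^ 9 * 1" by simp
            ultimately show "2304 * ?d < ?c" by (rule less_le_trans[rotated])
            show "0 < (A * B) * (R\<^sup>2 * ?g)" using A B R n1 by simp
          qed fact
          also have "\<dots> \<le> 3 * (?d - 1) * a n + ?c * (A * B) * (R\<^sup>2 * ?g) / b n"
            using d1 a0 by (simp add: mult_ac)
          also have "?g = real n powr (3 / 2)"
          proof -
            have "real n powr (3 / 2) = real n powr (1 + 1 / 2)" by simp
            also have "\<dots> = ?g" unfolding powr_add using n1 by (simp add: powr_half_sqrt)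
            finally show ?thesis ..
          qed
          finally have "ereal (procrustes_error n ?zh ?z) < ?bd n"
            unfolding bd by (simp add: R_def)
          moreover have "?bd n \<le> ereal (procrustes_error n ?zh ?z)" using Ev by blast
          ultimately show False by (meson not_le)
        qed
      qed
      then have "measure (M n) (?Ev n) \<le> measure (M n) E"
      \<comment> \<open>A nonmeasurable set has measure \<open>0\<close>.\<close>
      proof (cases "?Ev n \<in> sets (M n)")
        case False
        show ?thesis unfolding measure_notin_sets[OF False] by (rule measure_nonneg)
      qed (rule finite_measure_mono_AE[OF _ E(1)])
      also have "\<dots> \<le> 54 / (real n)\<^sup>2" using E(2) exp_minus_nat_le[OF n1] by linarith
      finally show ?thesis .
    qed
  qed
  \<comment> \<open>For \<open>n \<le> d\<close> the bound exceeds \<open>1\<close>.\<close>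
  have "measure (M n) (?Ev n) \<le> (?d\<^sup>2 + 54) / (real n)\<^sup>2" if n1: "n \<ge> 1" for n
  proof (cases "n > CARD('d)")
    case True
    have "54 / (real n)\<^sup>2 \<le> (?d\<^sup>2 + 54) / (real n)\<^sup>2" by (simp add: divide_right_mono)
    with large[OF True] show ?thesis by (rule order_trans)
  next
    case False
    interpret prob_space "M n" using lpm n1 by (simp add: lpm_def)
    have "(real n)\<^sup>2 \<le> ?d\<^sup>2 + 54" using False by (simp add: add_increasing2 power_mono)
    then have "1 \<le> (?d\<^sup>2 + 54) / (real n)\<^sup>2" using n1 by simp
    then show ?thesis using prob_le_1 order_trans by blast
  qed
  moreover have "0 < ?d\<^sup>2 + 54" by (simp add: add_nonneg_pos)
  ultimately show ?thesis by blast
qed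

end
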